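(* Let $d\in\mathbb{N}$ and let $R(z)=\sum_{i=1}^{d}\frac{a_i}{z-p_i}$ be a $d$-good rational function. Let $K:=\{z\in\hat{\mathbb{C}}:|R(z)|\ge 1\}$ and, for $i=1,\dots,d$, let $K_i$ be the connected component of $K$ containing $p_i$. Then \[ \mathrm{cap}(K_i)\ge |a_i|,\qquad i=1,\dots,d, \] and \[ \mathrm{cap}(K)\ge\Big[\prod_{\substack{i,j=1\\ i\ne j}}^{d}|p_i-p_j|\ \prod_{i=1}^{d}|a_i|\Big]^{\frac{1}{d^{2}}}, \] where the first product is over all ordered pairs $(i,j)$ with $i\neq j$.
   Context: $\mathbb{D}=\{z\in\mathbb{C}:|z|<1\}$ and $\hat{\mathbb{C}}$ is the extended complex plane. A rational function $R$ is called $d$-good ($d\in\mathbb{N}$) if it has degree $d$, $R(\infty)=0$, and the open set $\Omega:=R^{-1}(\mathbb{D})\subset\hat{\mathbb{C}}$ is connected and bounded by $d$ disjoint analytic Jordan curves $\gamma_1,\dots,\gamma_d$. In that case $R$ has exactly one pole $p_i$, which is simple, in the bounded component of $\hat{\mathbb{C}}\setminus\gamma_i$ for each $i$, and $R(z)=\sum_{i=1}^{d}\frac{a_i}{z-p_i}$ for some $a_i\in\mathbb{C}\setminus\{0\}$. The logarithmic capacity of a compact set $E\subset\mathbb{C}$ is $\mathrm{cap}(E)=e^{-I(E)}$, where $I(E)=\inf_\mu\iint\log\frac{1}{|z-w|}\,d\mu(z)\,d\mu(w)$, the infimum being over all Borel probability measures $\mu$ supported on $E$. *)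

theory Defs
  imports
    "HOL-Probability.Probability"
    "HOL-Complex_Analysis.Complex_Analysis"
    "HOL-Computational_Algebra.Computational_Algebra"
begin

section \<open>The extended complex plane and rational functions\<close>

text \<open>\<^term>\<open>None\<close> is the point at infinity.\<close>

definition riemann_sphere :: "complex option topology" where
  "riemann_sphere = Alexandroff_compactification euclidean"

definition cmod_ext :: "complex option \<Rightarrow> ereal" where
  "cmod_ext z = (case z of None \<Rightarrow> \<infinity> | Some w \<Rightarrow> ereal (cmod w))"

text \<open>
  The self-map of the sphere induced by the quotient \<open>P / Q\<close>. It is only used for coprime \<open>P\<close>
  and \<open>Q\<close>, so that the zeros of \<open>Q\<close> are exactly the finite poles. At infinity the value is the
  limit; the coefficient \<open>coeff P (degree Q)\<close> vanishes if \<open>degree P < degree Q\<close>.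
\<close>

definition rational_map :: "complex poly \<Rightarrow> complex poly \<Rightarrow> complex option \<Rightarrow> complex option" where
  "rational_map P Q z = (case z of
      None \<Rightarrow> if degree Q < degree P then None else Some (coeff P (degree Q) / lead_coeff Q)
    | Some w \<Rightarrow> if poly Q w = 0 then None else Some (poly P w / poly Q w))"

definition rational_function_of_degree :: "nat \<Rightarrow> (complex option \<Rightarrow> complex option) \<Rightarrow> bool" where
  "rational_function_of_degree d R \<longleftrightarrow>
     (\<exists>P Q. Q \<noteq> 0 \<and> coprime P Q \<and> max (degree P) (degree Q) = d \<and> R = rational_map P Q)"


section \<open>Good rational functions\<close>

definition analytic_Jordan_curve :: "complex set \<Rightarrow> bool" where
  "analytic_Jordan_curve C \<longleftrightarrow>
     (\<exists>\<phi> U. open U \<and> sphere 0 1 \<subseteq> U \<and> \<phi> holomorphic_on U \<and> inj_on \<phi> U \<and> C = \<phi> ` sphere 0 1)"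

text \<open>
  The boundary of \<open>\<Omega>\<close> is taken in the sphere. Since \<open>R(\<infinity>) = 0\<close>, the point at infinity is
  interior to \<open>\<Omega>\<close>, so the boundary curves lie in the finite plane.
\<close>

definition good_rational_function :: "nat \<Rightarrow> (complex option \<Rightarrow> complex option) \<Rightarrow> bool" where
  "good_rational_function d R \<longleftrightarrow>
     rational_function_of_degree d R \<and> R None = Some 0 \<and>
     (let \<Omega> = R -` {w. cmod_ext w < 1} in
        connectedin riemann_sphere \<Omega> \<and>
        (\<exists>\<gamma> :: nat \<Rightarrow> complex set.
           (\<forall>i\<in>{1..d}. analytic_Jordan_curve (\<gamma> i)) \<and>
           disjoint_family_on \<gamma> {1..d} \<and>
           riemann_sphere frontier_of \<Omega> = (\<Union>i\<in>{1..d}. Some ` \<gamma> i)))"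


section \<open>Logarithmic capacity\<close>

definition log_kernel :: "complex \<Rightarrow> complex \<Rightarrow> ereal" where
  "log_kernel z w = (if z = w then \<infinity> else ereal (ln (1 / cmod (z - w))))"

text \<open>
  The energy may be \<open>\<infinity>\<close>, so the double integral is taken in \<^typ>\<open>ereal\<close> as the difference of
  the integrals of the positive and the negative part (\<^const>\<open>e2ennreal\<close> sends negative values
  to \<open>0\<close>). The second integral is finite whenever \<open>\<mu>\<close> is a finite measure of bounded support.
\<close>

definition log_energy :: "complex measure \<Rightarrow> ereal" where
  "log_energy \<mu> =
     enn2ereal (\<integral>\<^sup>+ z. (\<integral>\<^sup>+ w. e2ennreal (log_kernel z w) \<partial>\<mu>) \<partial>\<mu>) -
     enn2ereal (\<integral>\<^sup>+ z. (\<integral>\<^sup>+ w. e2ennreal (- log_kernel z w) \<partial>\<mu>) \<partial>\<mu>)"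

definition probability_measures_on :: "complex set \<Rightarrow> complex measure set" where
  "probability_measures_on E = {\<mu>. sets \<mu> = sets borel \<and> prob_space \<mu> \<and> emeasure \<mu> E = 1}"

definition robin_constant :: "complex set \<Rightarrow> ereal" where
  "robin_constant E = (INF \<mu>\<in>probability_measures_on E. log_energy \<mu>)"

text \<open>
  Meant for compact \<open>E\<close>, for which \<^term>\<open>robin_constant E\<close> is never \<open>-\<infinity>\<close>. The first case is the
  convention \<open>e\<^sup>-\<^sup>\<infinity> = 0\<close>; it includes \<^term>\<open>E = {}\<close>.
\<close>

definition log_capacity :: "complex set \<Rightarrow> real" where
  "log_capacity E =
     (if robin_constant E = \<infinity> then 0 else exp (- real_of_ereal (robin_constant E)))"

end

(* On each interior V of a boundary curve, 1/R is a bijection onto the unit disc: 1/R = \<zeta> has a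
   solution in every one of the d interiors, and at most d solutions altogether. Its inverse f_i has
   f_i(0) = p_i and f_i'(0) = a_i. The image of the uniform measure on the circle of radius r < 1 under
   f_i is a competitor for the capacity of K_i, and the average of these d measures is one for K. Since
   (f_i(z) - f_i(w)) / (z - w), and f_i(z) - f_j(w) for distinct i and j, are holomorphic and zero-free,
   the mean value property of log|h| gives the mutual energies -log|a_i| - log r and -log|p_i - p_j|.
   Letting r tend to 1 no boundary behaviour of f_i enters. *)

theory Submission
  imports Defs
begin

section \<open>Logarithmic energy\<close>

text \<open>The self-energy cannot be evaluated directly: on a single circle the kernel is infinite
  on the diagonal. The second variable is therefore moved to a slightly smaller circle of radius
  \<rho> < r. For |z| = r the function w -> f_i(z) - f_j(w) is zero-free on |w| < r, by injectivity
  if i = j and by disjointness otherwise, so averaging over w replaces f_j(w) by f_j(0), whatever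
  \<rho> is. The average over z then meets only the difference quotient at 0. As \<rho> tends to r,
  Fatou's lemma turns these values into an upper bound for the energy, the direction that a
  competitor needs. The nonnegative integrals in \<open>log_energy\<close> are the reason for
  shifting the kernel by ln D, where D bounds the distances.

  Counting roots requires d disjoint interiors, so nested curves must be excluded. Connectedness of
  \<Omega> and infinity \<in> \<Omega> do this: \<Omega> avoids every interior, hence so does every
  boundary curve, as it lies in the closure of \<Omega>.\<close>

lemma log_norm_mean_value:
  assumes holo: "h holomorphic_on ball 0 R" and nz: "\<And>z. z \<in> ball 0 R \<Longrightarrow> h z \<noteq> 0"
    and r: "0 < r" "r < R"
  shows "((\<lambda>t. ln (cmod (h (circlepath 0 r t)))) has_integral ln (cmod (h 0))) {0..1}"
proof -
  \<comment> \<open>A zero-free function on a disc has a logarithm \<open>g\<close>, so ln |h| is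
    the real part of \<open>g\<close>, and Cauchy's formula computes the mean of \<open>g\<close>
    over the circle.\<close>
  obtain g where g: "g holomorphic_on ball 0 R" "\<And>z. z \<in> ball 0 R \<Longrightarrow> exp (g z) = h z"
    using holomorphic_logarithm_exists[of "ball 0 R" h 0] holo nz r by auto
  have Re_g: "Re (g z) = ln (cmod (h z))" if "z \<in> ball 0 R" for z
    using g(2)[OF that, symmetric] by simp
  have "g holomorphic_on cball 0 r"
    using g(1) by (rule holomorphic_on_subset) (use r in auto)
  from Cauchy_integral_circlepath_simple[OF this, of 0] r
  have "((\<lambda>u. g u / u) has_contour_integral 2 * of_real pi * \<i> * g 0) (circlepath 0 r)"
    by simp
  then have "((\<lambda>t. g (circlepath 0 r t) / circlepath 0 r t *
      vector_derivative (circlepath 0 r) (at t within {0..1})) has_integral 2 * of_real pi * \<i> * g 0) {0..1}"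
    by (simp add: has_contour_integral_def)
  \<comment> \<open>The derivative of \<open>circlepath 0 r\<close> is 2 pi i times the path itself,
    which cancels the Cauchy kernel.\<close>
  then have "((\<lambda>t. 2 * of_real pi * \<i> * g (circlepath 0 r t)) has_integral 2 * of_real pi * \<i> * g 0) {0..1}"
    by (rule has_integral_eq[rotated]) (use r in \<open>simp add: vector_derivative_circlepath01, simp add: circlepath\<close>)
  from has_integral_mult_right[OF this, of "1 / (2 * of_real pi * \<i>)"]
  have "((\<lambda>t. g (circlepath 0 r t)) has_integral g 0) {0..1}"
    by simp
  from has_integral_linear[OF this bounded_linear_Re]
  have "((\<lambda>t. Re (g (circlepath 0 r t))) has_integral Re (g 0)) {0..1}"
    by (simp add: o_def)
  moreover have "circlepath 0 r t \<in> ball 0 R" for t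
    using r by (simp add: circlepath norm_mult)
  ultimately show ?thesis
    using Re_g r by (simp add: Re_g)
qed

text \<open>The parameter measure for \<open>circlepath\<close>. It lives on the whole real line
  with its Borel sets, so that continuity on \<open>UNIV\<close> gives measurability without
  restriction to [0, 1].\<close>

definition unit_interval_measure :: "real measure" where
  "unit_interval_measure = uniform_measure lborel {0..1}"

lemma prob_space_unit_interval_measure: "prob_space unit_interval_measure"
  unfolding unit_interval_measure_def by (rule prob_space_uniform_measure) auto

lemma sets_unit_interval_measure [measurable_cong]: "sets unit_interval_measure = sets borel"
  by (simp add: unit_interval_measure_def)

lemma space_unit_interval_measure [simp]: "space unit_interval_measure = UNIV"
  by (simp add: unit_interval_measure_def)

text \<open>Passes from the gauge integral of \<open>log_norm_mean_value\<close> to the nonnegative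
  integrals of \<open>log_energy\<close>.\<close>

lemma nn_integral_unit_interval_measure:
  assumes "f \<in> borel_measurable borel" "\<And>t. 0 \<le> f t" "(f has_integral I) {0..1}"
  shows "(\<integral>\<^sup>+ t. ennreal (f t) \<partial>unit_interval_measure) = ennreal I"
proof -
  have "(\<integral>\<^sup>+ t. ennreal (f t) * indicator {0..1} t \<partial>lborel) = ennreal I"
    by (rule nn_integral_has_integral_lebesgue'[OF _ assms(3)]) (use assms in auto)
  then show ?thesis
    unfolding unit_interval_measure_def using assms(1)
    by (subst nn_integral_uniform_measure) (auto simp: divide_ennreal_def)
qed

lemma continuous_on_circlepath: "continuous_on A (circlepath z r)"
  unfolding circlepath by (intro continuous_intros)

lemma norm_circlepath [simp]: "0 \<le> r \<Longrightarrow> cmod (circlepath 0 r t) = r"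
  by (simp add: circlepath norm_mult)

text \<open>The bound \<open>C\<close> makes the integrand nonnegative. The first conclusion
  guarantees that \<open>ennreal\<close> truncates nothing on the right of the second.\<close>

lemma nn_integral_log_norm_circle:
  assumes holo: "h holomorphic_on ball 0 R" and nz: "\<And>z. z \<in> ball 0 R \<Longrightarrow> h z \<noteq> 0"
    and r: "0 < r" "r < R" and C: "\<And>z. cmod z = r \<Longrightarrow> ln (cmod (h z)) \<le> C"
  shows "ln (cmod (h 0)) \<le> C"
    and "(\<integral>\<^sup>+ t. ennreal (C - ln (cmod (h (circlepath 0 r t)))) \<partial>unit_interval_measure)
           = ennreal (C - ln (cmod (h 0)))"
proof -
  have int: "((\<lambda>t. C - ln (cmod (h (circlepath 0 r t)))) has_integral C - ln (cmod (h 0))) {0..1}"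
    using has_integral_diff[OF has_integral_const_real[of C 0 1] log_norm_mean_value[OF holo nz r]]
    by simp
  have nonneg: "0 \<le> C - ln (cmod (h (circlepath 0 r t)))" for t
    using C[of "circlepath 0 r t"] r by simp
  show "ln (cmod (h 0)) \<le> C"
    using has_integral_nonneg[OF int] nonneg by simp
  have "continuous_on UNIV (h \<circ> circlepath 0 r)"
    by (intro continuous_on_compose continuous_on_circlepath
        holomorphic_on_imp_continuous_on holomorphic_on_subset[OF holo])
       (use r in auto)
  then have "continuous_on UNIV (\<lambda>t. C - ln (cmod (h (circlepath 0 r t))))"
    using r by (intro continuous_intros) (auto simp: o_def nz)
  then have "(\<lambda>t. C - ln (cmod (h (circlepath 0 r t)))) \<in> borel_measurable borel"
    by (rule borel_measurable_continuous_onI)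
  from nn_integral_unit_interval_measure[OF this nonneg int]
  show "(\<integral>\<^sup>+ t. ennreal (C - ln (cmod (h (circlepath 0 r t)))) \<partial>unit_interval_measure)
           = ennreal (C - ln (cmod (h 0)))" .
qed

section \<open>The logarithmic kernel and the energy of an image measure\<close>

lemma borel_measurable_log_kernel [measurable]:
  assumes [measurable]: "f \<in> borel_measurable M" "g \<in> borel_measurable M"
  shows "(\<lambda>x. log_kernel (f x) (g x)) \<in> borel_measurable M"
  unfolding log_kernel_def by measurable

text \<open>With k the kernel and s = ln D, this is k = k+ - k- rearranged, using s \<ge> 0 and k +
  s \<ge> 0. The additive form avoids truncated subtraction and stays valid at z = w, where both
  sides are infinite.\<close>

lemma log_kernel_decomposition:
  assumes "1 \<le> D" "cmod (z - w) \<le> D"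
  shows "e2ennreal (log_kernel z w) + ennreal (ln D) =
         e2ennreal (log_kernel z w + ereal (ln D)) + e2ennreal (- log_kernel z w)"
proof (cases "z = w")
  case True
  then show ?thesis by (simp add: log_kernel_def e2ennreal_infty)
next
  case False
  define x where "x = ln (cmod (z - w))"
  have x: "x \<le> ln D" "0 \<le> ln D"
    using assms False by (auto simp: x_def)
  have k: "log_kernel z w = ereal (- x)"
    using False by (simp add: log_kernel_def x_def ln_div)
  show ?thesis
  proof (cases "x \<ge> 0")
    case True
    then show ?thesis
      using x by (simp add: k e2ennreal_ereal ennreal_neg flip: ennreal_plus)
  next
    case False
    then show ?thesis
      using x by (simp add: k e2ennreal_ereal ennreal_neg flip: ennreal_plus)
  qed
qed

lemma log_kernel_neg_le:
  assumes "1 \<le> D" "cmod (z - w) \<le> D"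
  shows "e2ennreal (- log_kernel z w) \<le> ennreal (ln D)"
proof (cases "z = w")
  case False
  then show ?thesis
    using assms by (auto simp: log_kernel_def e2ennreal_ereal ln_div intro!: ennreal_leI)
qed (simp add: log_kernel_def e2ennreal_neg)

lemma log_energy_distr:
  assumes [measurable]: "X \<in> borel_measurable N" and "prob_space N"
  shows "log_energy (distr N borel X) =
     enn2ereal (\<integral>\<^sup>+ x. (\<integral>\<^sup>+ y. e2ennreal (log_kernel (X x) (X y)) \<partial>N) \<partial>N) -
     enn2ereal (\<integral>\<^sup>+ x. (\<integral>\<^sup>+ y. e2ennreal (- log_kernel (X x) (X y)) \<partial>N) \<partial>N)"
proof -
  interpret prob_space N by fact
  interpret D: prob_space "distr N borel X" by (rule prob_space_distr) simp
  have [measurable]: "e2ennreal \<in> borel_measurable borel"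
    by (rule measurable_e2ennreal)
  show ?thesis
    unfolding log_energy_def by (simp add: nn_integral_distr)
qed

lemma (in prob_space) nn_integral_le_const_AE:
  assumes "AE x in M. f x \<le> c"
  shows "(\<integral>\<^sup>+ x. f x \<partial>M) \<le> c"
  using nn_integral_mono_AE[OF assms] by (simp add: emeasure_space_1)

text \<open>The approximants \<open>Y n\<close> keep the kernel off its singularity, where the energy can be computed;
  Fatou's lemma then only loses in the favourable direction.\<close>

lemma log_energy_distr_le:
  assumes N: "prob_space N"
    and X [measurable]: "X \<in> borel_measurable N" and Y [measurable]: "\<And>n. Y n \<in> borel_measurable N"
    and lim: "\<And>x. x \<in> space N \<Longrightarrow> (\<lambda>n. Y n x) \<longlonglongrightarrow> X x"
    and ne: "\<And>x y n. x \<in> space N \<Longrightarrow> y \<in> space N \<Longrightarrow> X x \<noteq> Y n y"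
    and D: "1 \<le> D" "\<And>x y. x \<in> space N \<Longrightarrow> y \<in> space N \<Longrightarrow> cmod (X x - X y) \<le> D"
    and m: "0 \<le> m" "\<And>n. (\<integral>\<^sup>+ x. (\<integral>\<^sup>+ y. ennreal (ln D - ln (cmod (X x - Y n y))) \<partial>N) \<partial>N) \<le> ennreal m"
  shows "log_energy (distr N borel X) \<le> ereal (m - ln D)"
proof -
  interpret prob_space N by fact
  have [measurable]: "e2ennreal \<in> borel_measurable borel"
    by (rule measurable_e2ennreal)
  \<comment> \<open>The shift makes the kernel nonnegative at all pairs of values of
    \<open>X\<close>, so \<open>e2ennreal\<close> loses nothing there.\<close>
  define L where "L z w = e2ennreal (log_kernel z w + ereal (ln D))" for z w
  have [measurable]: "(\<lambda>x. L (f x) (g x)) \<in> borel_measurable M"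
    if "f \<in> borel_measurable M" "g \<in> borel_measurable M" for M :: "'c measure" and f g
    using that unfolding L_def by measurable
  define A where "A = (\<integral>\<^sup>+ x. (\<integral>\<^sup>+ y. e2ennreal (log_kernel (X x) (X y)) \<partial>N) \<partial>N)"
  define B where "B = (\<integral>\<^sup>+ x. (\<integral>\<^sup>+ y. e2ennreal (- log_kernel (X x) (X y)) \<partial>N) \<partial>N)"
  have "A + ennreal (ln D) = (\<integral>\<^sup>+ x. (\<integral>\<^sup>+ y. e2ennreal (log_kernel (X x) (X y)) + ennreal (ln D) \<partial>N) \<partial>N)"
    unfolding A_def by (simp add: nn_integral_add emeasure_space_1)
  also have "\<dots> = (\<integral>\<^sup>+ x. (\<integral>\<^sup>+ y. L (X x) (X y) + e2ennreal (- log_kernel (X x) (X y)) \<partial>N) \<partial>N)"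
    unfolding L_def
    by (intro nn_integral_cong log_kernel_decomposition D)
  also have "\<dots> = (\<integral>\<^sup>+ x. (\<integral>\<^sup>+ y. L (X x) (X y) \<partial>N) \<partial>N) + B"
    unfolding B_def by (simp add: nn_integral_add)
  finally have AB: "A + ennreal (ln D) = (\<integral>\<^sup>+ x. (\<integral>\<^sup>+ y. L (X x) (X y) \<partial>N) \<partial>N) + B" .
  have L_ne: "L z w = ennreal (ln D - ln (cmod (z - w)))" if "z \<noteq> w" for z w
    using that by (simp add: L_def log_kernel_def ln_div e2ennreal_ereal)
  have L_lim: "(\<lambda>n. L (X x) (Y n y)) \<longlonglongrightarrow> L (X x) (X y)" if xy: "x \<in> space N" "y \<in> space N" for x y
  proof -
    have *: "(\<lambda>n. cmod (X x - Y n y)) \<longlonglongrightarrow> cmod (X x - X y)"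
      by (intro tendsto_intros lim xy)
    show ?thesis
    proof (cases "X x = X y")
      case True
      \<comment> \<open>The distances tend to 0 but never vanish, by \<open>ne\<close>. So the
        kernel blows up along the sequence and matches its value \<infinity> on the
        diagonal.\<close>
      have "filterlim (\<lambda>n. cmod (X x - Y n y)) (at_right 0) sequentially"
        using * ne[OF xy] True by (auto simp: filterlim_at)
      from filterlim_compose[OF ln_at_0 this]
      have "filterlim (\<lambda>n. ln D + - ln (cmod (X x - Y n y))) at_top sequentially"
        by (intro filterlim_tendsto_add_at_top[OF tendsto_const])
           (simp add: filterlim_uminus_at_bot)
      then have "(\<lambda>n. ennreal (ln D + - ln (cmod (X x - Y n y)))) \<longlonglongrightarrow> \<infinity>"
        by (intro ennreal_tendsto_top_eq_at_top[THEN iffD2, unfolded infinity_ennreal_def[symmetric]])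
      then show ?thesis
        using True ne[OF xy] by (simp add: L_ne) (simp add: L_def log_kernel_def e2ennreal_infty)
    next
      case False
      then show ?thesis
        using * ne[OF xy] by (simp add: L_ne) (intro tendsto_intros *, auto)
    qed
  qed
  have "(\<integral>\<^sup>+ x. (\<integral>\<^sup>+ y. L (X x) (X y) \<partial>N) \<partial>N)
      = (\<integral>\<^sup>+ x. (\<integral>\<^sup>+ y. liminf (\<lambda>n. L (X x) (Y n y)) \<partial>N) \<partial>N)"
    by (intro nn_integral_cong lim_imp_Liminf[symmetric] L_lim) auto
  also have "\<dots> \<le> (\<integral>\<^sup>+ x. liminf (\<lambda>n. \<integral>\<^sup>+ y. L (X x) (Y n y) \<partial>N) \<partial>N)"
    by (intro nn_integral_mono nn_integral_liminf) auto
  also have "\<dots> \<le> liminf (\<lambda>n. \<integral>\<^sup>+ x. (\<integral>\<^sup>+ y. L (X x) (Y n y) \<partial>N) \<partial>N)"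
    by (intro nn_integral_liminf) auto
  also have "\<dots> = liminf (\<lambda>n. \<integral>\<^sup>+ x. (\<integral>\<^sup>+ y. ennreal (ln D - ln (cmod (X x - Y n y))) \<partial>N) \<partial>N)"
    by (intro arg_cong[of _ _ liminf] ext nn_integral_cong L_ne ne)
  also have "\<dots> \<le> liminf (\<lambda>n::nat. ennreal m)"
    by (intro Liminf_mono always_eventually allI m)
  also have "\<dots> = ennreal m"
    by (simp add: Liminf_const)
  finally have le: "A + ennreal (ln D) \<le> ennreal m + B"
    unfolding AB by (intro add_right_mono)
  have "B \<le> ennreal (ln D)"
    unfolding B_def by (intro nn_integral_le_const_AE AE_I2 log_kernel_neg_le D)
  then obtain b where b: "B = ennreal b" "0 \<le> b"
    by (cases B) (auto simp: top_unique)
  \<comment> \<open>The energy is a difference in \<open>ereal\<close>; finiteness of both parts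
    allows the additive inequality \<open>le\<close> to be read as one between reals.\<close>
  have "A < \<infinity>"
    using le b by (cases A) (auto simp: top_unique simp flip: ennreal_plus)
  then obtain a where a: "A = ennreal a" "0 \<le> a"
    by (cases A) auto
  have "a + ln D \<le> m + b"
    using le a b m D(1) by (simp flip: ennreal_plus)
  then show ?thesis
    unfolding log_energy_distr[OF X N] A_def[symmetric] B_def[symmetric] a(1) b(1)
    using a b by simp
qed

section \<open>From the Robin constant to the capacity\<close>

lemma robin_constant_bounded_ge:
  assumes "\<And>z w. z \<in> E \<Longrightarrow> w \<in> E \<Longrightarrow> cmod (z - w) \<le> D" "1 \<le> D"
  shows "ereal (- ln D) \<le> robin_constant E"
  unfolding robin_constant_def
proof (rule INF_greatest)
  fix \<mu> assume \<mu>: "\<mu> \<in> probability_measures_on E"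
  then have [measurable_cong]: "sets \<mu> = sets borel" and "prob_space \<mu>" and E1: "emeasure \<mu> E = 1"
    by (auto simp: probability_measures_on_def)
  interpret prob_space \<mu> by fact
  \<comment> \<open>\<open>emeasure\<close> is 0 by default outside the sigma-algebra, so the value
    1 forces measurability.\<close>
  have "E \<in> sets \<mu>"
    using E1 emeasure_notin_sets[of E \<mu>] by auto
  then have AE: "AE x in \<mu>. x \<in> E"
    using E1 by (simp add: AE_in_set_eq_1 measure_def)
  define B where "B = (\<integral>\<^sup>+ z. (\<integral>\<^sup>+ w. e2ennreal (- log_kernel z w) \<partial>\<mu>) \<partial>\<mu>)"
  have "(\<integral>\<^sup>+ w. e2ennreal (- log_kernel z w) \<partial>\<mu>) \<le> ennreal (ln D)" if "z \<in> E" for z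
    using AE by (intro nn_integral_le_const_AE) (auto intro!: log_kernel_neg_le assms that elim!: eventually_mono)
  then have "B \<le> ennreal (ln D)"
    unfolding B_def using AE by (intro nn_integral_le_const_AE) (auto elim!: eventually_mono)
  then obtain b where b: "B = ennreal b" "0 \<le> b" "b \<le> ln D"
    using assms(2) by (cases B) (auto simp: top_unique)
  have "0 \<le> enn2ereal (\<integral>\<^sup>+ z. (\<integral>\<^sup>+ w. e2ennreal (log_kernel z w) \<partial>\<mu>) \<partial>\<mu>)"
    by simp
  then show "ereal (- ln D) \<le> log_energy \<mu>"
    unfolding log_energy_def B_def[symmetric] b(1)
    using b(2,3) by (cases "enn2ereal (\<integral>\<^sup>+ z. (\<integral>\<^sup>+ w. e2ennreal (log_kernel z w) \<partial>\<mu>) \<partial>\<mu>)") auto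
qed

text \<open>The lower bound on the Robin constant is essential: at -\<infinity>
  \<open>real_of_ereal\<close> returns 0, and \<open>log_capacity\<close> would take the spurious
  value 1.\<close>

lemma log_capacity_ge:
  assumes "bounded E" "robin_constant E \<le> ereal c"
  shows "exp (- c) \<le> log_capacity E"
proof -
  obtain D where D: "\<And>z w. z \<in> E \<Longrightarrow> w \<in> E \<Longrightarrow> cmod (z - w) \<le> D"
    using \<open>bounded E\<close> unfolding bounded_two_points dist_norm by blast
  have "ereal (- ln (max 1 D)) \<le> robin_constant E"
    by (rule robin_constant_bounded_ge) (auto intro: D order_trans)
  then show ?thesis
    using assms(2) by (cases "robin_constant E") (auto simp: log_capacity_def)
qed

section \<open>Capacity of a set containing disjoint conformal discs\<close>

text \<open>One probability space carrying all the circles: its image under (i, t) -> f_i(r e^(2 pi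
  i t)), with the imaginary unit in the exponent, is the average of the single image measures. A
  one-element index set covers the case of one component.\<close>

definition circle_copies :: "'i set \<Rightarrow> ('i \<times> real) measure" where
  "circle_copies I = uniform_count_measure I \<Otimes>\<^sub>M unit_interval_measure"

lemma sets_circle_copies [measurable_cong]:
  "sets (circle_copies I) = sets (count_space I \<Otimes>\<^sub>M borel)"
  unfolding circle_copies_def
  by (intro sets_pair_measure_cong) (simp_all add: sets_uniform_count_measure sets_unit_interval_measure)

lemma space_circle_copies: "space (circle_copies I) = I \<times> UNIV"
  by (simp add: circle_copies_def space_pair_measure space_uniform_count_measure)

lemma prob_space_circle_copies:
  "finite I \<Longrightarrow> I \<noteq> {} \<Longrightarrow> prob_space (circle_copies I)"
  unfolding circle_copies_def
  by (intro prob_space_pair prob_space_uniform_count_measure prob_space_unit_interval_measure)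

lemma borel_measurable_circle_copies:
  assumes "finite I" "\<And>i. i \<in> I \<Longrightarrow> F i \<in> borel_measurable borel"
  shows "(\<lambda>(i, t). F i t) \<in> borel_measurable (circle_copies I)"
proof -
  have "(\<lambda>(i, t). F i t) \<in> borel_measurable (count_space I \<Otimes>\<^sub>M borel)"
    by (rule measurable_pair_measure_countable1) (use assms in \<open>auto intro: countable_finite\<close>)
  then show ?thesis
    by (simp cong: measurable_cong_sets add: sets_circle_copies)
qed

lemma nn_integral_circle_copies:
  assumes I: "finite I" and F: "F \<in> borel_measurable (circle_copies I)"
  shows "(\<integral>\<^sup>+ x. F x \<partial>circle_copies I) =
    (\<Sum>i\<in>I. ennreal (1 / real (card I)) * (\<integral>\<^sup>+ t. F (i, t) \<partial>unit_interval_measure))"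
proof -
  interpret U: prob_space unit_interval_measure
    by (rule prob_space_unit_interval_measure)
  have "(\<integral>\<^sup>+ x. F x \<partial>circle_copies I) =
      (\<integral>\<^sup>+ i. (\<integral>\<^sup>+ t. F (i, t) \<partial>unit_interval_measure) \<partial>uniform_count_measure I)"
    using F unfolding circle_copies_def by (rule U.nn_integral_fst[symmetric])
  also have "\<dots> = (\<Sum>i\<in>I. ennreal (1 / real (card I)) * (\<integral>\<^sup>+ t. F (i, t) \<partial>unit_interval_measure))"
    unfolding uniform_count_measure_def using I by (rule nn_integral_point_measure_finite)
  finally show ?thesis .
qed

lemma borel_measurable_circlepath_comp:
  assumes "f holomorphic_on ball 0 1" "0 \<le> r" "r < 1"
  shows "(\<lambda>t. f (circlepath 0 r t)) \<in> borel_measurable borel"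
proof (rule borel_measurable_continuous_onI)
  have "continuous_on UNIV (f \<circ> circlepath 0 r)"
    by (intro continuous_on_compose continuous_on_circlepath
        holomorphic_on_imp_continuous_on holomorphic_on_subset[OF assms(1)])
       (use assms in auto)
  then show "continuous_on UNIV (\<lambda>t. f (circlepath 0 r t))"
    by (simp add: o_def)
qed

text \<open>The quotient (f(z) - f(0)) / z, extended by f'(0), is holomorphic, and injectivity makes
  it zero-free, also at 0. On |z| = r the factor z contributes the constant ln r.\<close>

lemma nn_integral_log_difference_quotient:
  assumes holo: "f holomorphic_on ball 0 1" and inj: "inj_on f (ball 0 1)"
    and r: "0 < r" "r < 1" and C: "\<And>z. cmod z = r \<Longrightarrow> ln (cmod (f z - f 0)) \<le> C"
  shows "ln r + ln (cmod (deriv f 0)) \<le> C"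
    and "(\<integral>\<^sup>+ t. ennreal (C - ln (cmod (f (circlepath 0 r t) - f 0))) \<partial>unit_interval_measure)
           = ennreal (C - ln r - ln (cmod (deriv f 0)))"
proof -
  define h where "h z = (if z = 0 then deriv f 0 else (f z - f 0) / z)" for z
  have "deriv (\<lambda>z. f z - f 0) 0 = deriv f 0"
    using holo by (subst deriv_diff) (auto intro: holomorphic_on_imp_differentiable_at)
  moreover have "(\<lambda>z. f z - f 0) holomorphic_on ball 0 1"
    by (intro holomorphic_intros holo)
  ultimately have h_holo: "h holomorphic_on ball 0 1"
    using pole_theorem_open_0[of "\<lambda>z. f z - f 0" "ball 0 1" 0 h] by (simp add: h_def)
  have h_nz: "h z \<noteq> 0" if "z \<in> ball 0 1" for z
    using holomorphic_injective_imp_regular[OF holo open_ball inj, of 0] inj_onD[OF inj, of z 0] that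
    by (auto simp: h_def)
  have h_ln: "ln (cmod (f z - f 0)) = ln r + ln (cmod (h z))" if "cmod z = r" for z
  proof -
    have "f z - f 0 = z * h z" "h z \<noteq> 0"
      using that r h_nz[of z] by (auto simp: h_def)
    then show ?thesis
      using that r by (simp add: norm_mult ln_mult)
  qed
  have C': "ln (cmod (h z)) \<le> C - ln r" if "cmod z = r" for z
    using C[OF that] h_ln[OF that] by simp
  show "ln r + ln (cmod (deriv f 0)) \<le> C"
    using nn_integral_log_norm_circle(1)[OF h_holo h_nz r C'] by (simp add: h_def)
  have "(\<integral>\<^sup>+ t. ennreal (C - ln (cmod (f (circlepath 0 r t) - f 0))) \<partial>unit_interval_measure) =
      (\<integral>\<^sup>+ t. ennreal (C - ln r - ln (cmod (h (circlepath 0 r t)))) \<partial>unit_interval_measure)"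
    using r by (intro nn_integral_cong) (simp add: h_ln algebra_simps)
  also have "\<dots> = ennreal (C - ln r - ln (cmod (h 0)))"
    by (rule nn_integral_log_norm_circle(2)[OF h_holo h_nz r C'])
  finally show "(\<integral>\<^sup>+ t. ennreal (C - ln (cmod (f (circlepath 0 r t) - f 0))) \<partial>unit_interval_measure)
           = ennreal (C - ln r - ln (cmod (deriv f 0)))"
    by (simp add: h_def)
qed

text \<open>The competitor is the image of the circles of radius \<open>r\<close>. Its energy is
  bounded by two successive mean values, first in w and then in z. Only the diagonal pairs produce
  -ln r; since this is positive, it is granted to all pairs, which keeps the bound uniform.\<close>

lemma robin_constant_conformal_images_le:
  fixes f :: "'i \<Rightarrow> complex \<Rightarrow> complex"
  assumes I: "finite I" "I \<noteq> {}"
    and holo: "\<And>i. i \<in> I \<Longrightarrow> f i holomorphic_on ball 0 1"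
    and inj: "\<And>i. i \<in> I \<Longrightarrow> inj_on (f i) (ball 0 1)"
    and disj: "disjoint_family_on (\<lambda>i. f i ` ball 0 1) I"
    and E: "bounded E" "E \<in> sets borel" "\<And>i. i \<in> I \<Longrightarrow> f i ` ball 0 1 \<subseteq> E"
    and r: "0 < r" "r < 1"
  shows "robin_constant E \<le>
    ereal (- ln r - (\<Sum>i\<in>I. \<Sum>j\<in>I.
        if i = j then ln (cmod (deriv (f i) 0)) else ln (cmod (f i 0 - f j 0))) / (real (card I))\<^sup>2)"
proof -
  define n where "n = real (card I)"
  have n: "n > 0"
    using I by (simp add: n_def card_gt_0_iff)
  define S where "S i j = (if i = j then ln (cmod (deriv (f i) 0)) else ln (cmod (f i 0 - f j 0)))" for i j
  obtain D' where D': "\<And>z w. z \<in> E \<Longrightarrow> w \<in> E \<Longrightarrow> cmod (z - w) \<le> D'"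
    using \<open>bounded E\<close> unfolding bounded_two_points dist_norm by blast
  define D where "D = max 1 D'"
  have D1: "1 \<le> D" and D: "\<And>z w. z \<in> E \<Longrightarrow> w \<in> E \<Longrightarrow> cmod (z - w) \<le> D"
    using D' by (auto simp: D_def le_max_iff_disj)
  have in_E: "f i z \<in> E" if "i \<in> I" "cmod z < 1" for i z
    using E(3)[of i] that by auto
  have ln_le: "ln (cmod (f i z - f j w)) \<le> ln D"
    if "i \<in> I" "j \<in> I" "cmod z < 1" "cmod w < 1" "f i z \<noteq> f j w" for i j z w
    using D[OF in_E[of i z] in_E[of j w]] D1 that by (subst ln_le_cancel_iff) auto
  have ne: "f i z \<noteq> f j w" if "i \<in> I" "j \<in> I" "cmod z < 1" "cmod w < 1" "i \<noteq> j \<or> z \<noteq> w" for i j z w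
  proof (cases "i = j")
    case True
    then show ?thesis using inj_onD[OF inj[of i], of z w] that by auto
  next
    case False
    then have "f i ` ball 0 1 \<inter> f j ` ball 0 1 = {}"
      using disjoint_family_onD[OF disj] that by blast
    moreover have "f i z \<in> f i ` ball 0 1" "f j w \<in> f j ` ball 0 1"
      using that by auto
    ultimately show ?thesis by (metis disjoint_iff)
  qed
  define N where "N = circle_copies I"
  interpret N: prob_space N
    unfolding N_def by (rule prob_space_circle_copies) fact+
  have space_N: "space N = I \<times> UNIV"
    by (simp add: N_def space_circle_copies)
  \<comment> \<open>Positive radii below \<open>r\<close> that tend to \<open>r\<close>; the 2 in
    the denominator keeps the radius positive at k = 0.\<close>
  define \<rho> where "\<rho> k = r * (1 - 1 / (real k + 2))" for k :: nat
  have \<rho>: "0 < \<rho> k" "\<rho> k < r" "\<rho> k < 1" for k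
  proof -
    show "0 < \<rho> k" "\<rho> k < r"
      using r by (auto simp: \<rho>_def field_simps add_pos_nonneg)
    then show "\<rho> k < 1"
      using r by simp
  qed
  have \<rho>_lim: "\<rho> \<longlonglongrightarrow> r"
    unfolding \<rho>_def by real_asymp
  define X where "X = (\<lambda>(i, t). f i (circlepath 0 r t))"
  define Y where "Y k = (\<lambda>(i, t). f i (circlepath 0 (\<rho> k) t))" for k
  have X_meas [measurable]: "X \<in> borel_measurable N"
    unfolding X_def N_def using r
    by (intro borel_measurable_circle_copies borel_measurable_circlepath_comp I holo) auto
  have Y_meas [measurable]: "Y k \<in> borel_measurable N" for k
    unfolding Y_def N_def using \<rho>[of k]
    by (intro borel_measurable_circle_copies borel_measurable_circlepath_comp I holo) auto
  have inner: "(\<integral>\<^sup>+ y. ennreal (ln D - ln (cmod (X x - Y k y))) \<partial>N) =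
      (\<Sum>j\<in>I. ennreal (1 / n) * ennreal (ln D - ln (cmod (X x - f j 0))))" if x_in: "x \<in> space N" for x k
  proof -
    obtain i t where x: "x = (i, t)" "i \<in> I"
      using x_in by (auto simp: space_N)
    define z where "z = circlepath 0 r t"
    have z: "cmod z = r" "X x = f i z"
      using r by (auto simp: z_def x X_def)
    have "(\<integral>\<^sup>+ y. ennreal (ln D - ln (cmod (X x - Y k y))) \<partial>N) =
      (\<Sum>j\<in>I. ennreal (1 / n) * (\<integral>\<^sup>+ s. ennreal (ln D - ln (cmod (X x - Y k (j, s)))) \<partial>unit_interval_measure))"
      unfolding N_def n_def
      by (intro nn_integral_circle_copies I) (fold N_def, measurable)
    also have "\<dots> = (\<Sum>j\<in>I. ennreal (1 / n) * ennreal (ln D - ln (cmod (X x - f j 0))))"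
    proof (rule sum.cong, rule refl, rule arg_cong[where f = "\<lambda>u. ennreal (1 / n) * u"])
      fix j assume j: "j \<in> I"
      have "(\<integral>\<^sup>+ s. ennreal (ln D - ln (cmod (f i z - f j (circlepath 0 (\<rho> k) s)))) \<partial>unit_interval_measure)
          = ennreal (ln D - ln (cmod (f i z - f j 0)))"
      \<comment> \<open>The disc of radius \<open>r\<close> is exactly where zero-freeness holds:
        for i = j the function vanishes at w = z, and |z| = r.\<close>
      proof (rule nn_integral_log_norm_circle(2)[where h = "\<lambda>w. f i z - f j w" and R = r])
        show "(\<lambda>w. f i z - f j w) holomorphic_on ball 0 r"
          using r by (intro holomorphic_intros holomorphic_on_subset[OF holo[OF j]]) auto
        show "f i z - f j w \<noteq> 0" if "w \<in> ball 0 r" for w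
          using ne[of i j z w] that x j z r by auto
        show "ln (cmod (f i z - f j w)) \<le> ln D" if "cmod w = \<rho> k" for w
          using \<rho>[of k] r z that by (intro ln_le ne x j) auto
      qed (use \<rho> in auto)
      then show "(\<integral>\<^sup>+ s. ennreal (ln D - ln (cmod (X x - Y k (j, s)))) \<partial>unit_interval_measure)
          = ennreal (ln D - ln (cmod (X x - f j 0)))"
        by (simp add: z Y_def)
    qed
    finally show ?thesis .
  qed
  \<comment> \<open>The first conjunct keeps the right-hand side free of truncation, so that the
    terms can later be summed as reals.\<close>
  have outer: "S i j + ln r \<le> ln D \<and>
      (\<integral>\<^sup>+ t. ennreal (ln D - ln (cmod (X (i, t) - f j 0))) \<partial>unit_interval_measure) \<le> ennreal (ln D - ln r - S i j)"
    if ij: "i \<in> I" "j \<in> I" for i j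
  proof (cases "i = j")
    case True
    have "ln (cmod (f i z - f i 0)) \<le> ln D" if "cmod z = r" for z
      using that r by (intro ln_le ne ij) auto
    from nn_integral_log_difference_quotient[OF holo inj r this] ij True
    show ?thesis
      by (simp add: S_def X_def)
  next
    case False
    have "(\<lambda>z. f i z - f j 0) holomorphic_on ball 0 1"
      by (intro holomorphic_intros holo ij)
    moreover have "f i z - f j 0 \<noteq> 0" if "z \<in> ball 0 1" for z
      using ne[of i j z 0] that ij False by auto
    moreover have "ln (cmod (f i z - f j 0)) \<le> ln D" if "cmod z = r" for z
      using that r by (intro ln_le ne ij) (auto simp: False)
    ultimately have "ln (cmod (f i 0 - f j 0)) \<le> ln D"
      "(\<integral>\<^sup>+ t. ennreal (ln D - ln (cmod (f i (circlepath 0 r t) - f j 0))) \<partial>unit_interval_measure)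
        = ennreal (ln D - ln (cmod (f i 0 - f j 0)))"
      using nn_integral_log_norm_circle[of "\<lambda>z. f i z - f j 0" 1 r "ln D"] r by auto
    moreover have "ln r \<le> 0"
      using r by simp
    ultimately show ?thesis
      using False by (auto simp: S_def X_def intro!: ennreal_leI)
  qed
  \<comment> \<open>Each 1 / n is the weight of one disc. The weights sum to 1 in each index, so ln
    D survives with coefficient 1 and cancels the shift in
    \<open>log_energy_distr_le\<close>.\<close>
  define m where "m = (\<Sum>i\<in>I. (1 / n) * (\<Sum>j\<in>I. (1 / n) * (ln D - ln r - S i j)))"
  have term_nonneg: "0 \<le> ln D - ln r - S i j" if "i \<in> I" "j \<in> I" for i j
    using outer[OF that] by simp
  have m: "0 \<le> m"
    unfolding m_def using term_nonneg n by (intro sum_nonneg mult_nonneg_nonneg) auto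
  have "(\<integral>\<^sup>+ x. (\<integral>\<^sup>+ y. ennreal (ln D - ln (cmod (X x - Y k y))) \<partial>N) \<partial>N) \<le> ennreal m" for k
  proof -
    have "(\<integral>\<^sup>+ x. (\<integral>\<^sup>+ y. ennreal (ln D - ln (cmod (X x - Y k y))) \<partial>N) \<partial>N) =
        (\<integral>\<^sup>+ x. (\<Sum>j\<in>I. ennreal (1 / n) * ennreal (ln D - ln (cmod (X x - f j 0)))) \<partial>N)"
      by (intro nn_integral_cong inner)
    also have "\<dots> = (\<Sum>i\<in>I. ennreal (1 / n) * (\<integral>\<^sup>+ t.
        (\<Sum>j\<in>I. ennreal (1 / n) * ennreal (ln D - ln (cmod (X (i, t) - f j 0)))) \<partial>unit_interval_measure))"
      unfolding N_def n_def by (intro nn_integral_circle_copies I) (fold N_def, measurable)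
    also have "\<dots> \<le> (\<Sum>i\<in>I. ennreal (1 / n) * (\<Sum>j\<in>I. ennreal (1 / n) * ennreal (ln D - ln r - S i j)))"
    proof (intro sum_mono mult_left_mono)
      fix i assume i: "i \<in> I"
      have [measurable]: "(\<lambda>t. X (i, t)) \<in> borel_measurable borel"
        unfolding X_def using r i by (auto intro: borel_measurable_circlepath_comp holo)
      have "(\<integral>\<^sup>+ t. (\<Sum>j\<in>I. ennreal (1 / n) * ennreal (ln D - ln (cmod (X (i, t) - f j 0)))) \<partial>unit_interval_measure)
          = (\<Sum>j\<in>I. ennreal (1 / n) * (\<integral>\<^sup>+ t. ennreal (ln D - ln (cmod (X (i, t) - f j 0))) \<partial>unit_interval_measure))"
        by (simp add: nn_integral_sum nn_integral_cmult)
      also have "\<dots> \<le> (\<Sum>j\<in>I. ennreal (1 / n) * ennreal (ln D - ln r - S i j))"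
        using outer i by (intro sum_mono mult_left_mono) auto
      finally show "(\<integral>\<^sup>+ t. (\<Sum>j\<in>I. ennreal (1 / n) * ennreal (ln D - ln (cmod (X (i, t) - f j 0)))) \<partial>unit_interval_measure)
          \<le> (\<Sum>j\<in>I. ennreal (1 / n) * ennreal (ln D - ln r - S i j))" .
    qed auto
    also have "\<dots> = ennreal m"
      unfolding m_def using n term_nonneg
      by (simp add: ennreal_mult' [symmetric] sum_ennreal sum_nonneg)
    finally show ?thesis .
  qed
  moreover have "(\<lambda>k. Y k x) \<longlonglongrightarrow> X x" if x_in: "x \<in> space N" for x
  proof -
    obtain i t where x: "x = (i, t)" "i \<in> I"
      using x_in by (auto simp: space_N)
    have "(\<lambda>k. circlepath 0 (\<rho> k) t) \<longlonglongrightarrow> circlepath 0 r t"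
      unfolding circlepath by (intro tendsto_intros \<rho>_lim)
    moreover have "isCont (f i) (circlepath 0 r t)"
      using holomorphic_on_imp_continuous_on[OF holo[OF x(2)]] r
      by (simp add: continuous_on_eq_continuous_at)
    ultimately show ?thesis
      unfolding x X_def Y_def by (auto intro: isCont_tendsto_compose)
  qed
  moreover have "X x \<noteq> Y k y" "cmod (X x - X y) \<le> D" if xy_in: "x \<in> space N" "y \<in> space N" for x y k
  proof -
    obtain i t j s where xy: "x = (i, t)" "i \<in> I" "y = (j, s)" "j \<in> I"
      using xy_in by (auto simp: space_N)
    have "circlepath 0 r t \<noteq> circlepath 0 (\<rho> k) s"
      using \<rho>[of k] r norm_circlepath[of r t] norm_circlepath[of "\<rho> k" s] by force
    then show "X x \<noteq> Y k y"
      unfolding xy X_def Y_def using \<rho>[of k] r xy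
        ne[of i j "circlepath 0 r t" "circlepath 0 (\<rho> k) s"] by auto
    show "cmod (X x - X y) \<le> D"
      unfolding xy X_def using r xy by (auto intro!: D in_E)
  qed
  ultimately have energy: "log_energy (distr N borel X) \<le> ereal (m - ln D)"
    by (intro log_energy_distr_le[where Y = Y] N.prob_space_axioms X_meas Y_meas D1 m) auto
  have "X -` E \<inter> space N = space N"
    using r by (auto simp: space_N X_def intro!: in_E)
  then have "distr N borel X \<in> probability_measures_on E"
    unfolding probability_measures_on_def
    using E(2) by (auto intro: N.prob_space_distr simp: emeasure_distr N.emeasure_space_1)
  then have "robin_constant E \<le> ereal (m - ln D)"
    unfolding robin_constant_def using energy by (rule INF_lower2)
  also have "m = ln D - ln r - (\<Sum>i\<in>I. \<Sum>j\<in>I. S i j) / n\<^sup>2"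
  proof -
    have "m = (\<Sum>i\<in>I. \<Sum>j\<in>I. (ln D - ln r) - S i j) / n\<^sup>2"
      by (simp add: m_def sum_distrib_left sum_divide_distrib power2_eq_square)
    also have "(\<Sum>i\<in>I. \<Sum>j\<in>I. u - S i j) = n\<^sup>2 * u - (\<Sum>i\<in>I. \<Sum>j\<in>I. S i j)" for u
      by (simp add: sum_subtractf n_def power2_eq_square)
    also have "(n\<^sup>2 * (ln D - ln r) - (\<Sum>i\<in>I. \<Sum>j\<in>I. S i j)) / n\<^sup>2 = ln D - ln r - (\<Sum>i\<in>I. \<Sum>j\<in>I. S i j) / n\<^sup>2"
      using n by (simp add: diff_divide_distrib)
    finally show ?thesis .
  qed
  finally show ?thesis
    by (simp add: S_def n_def)
qed

text \<open>Every \<open>r\<close> < 1 gives a competitor on the same set E, so only the numerical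
  bound passes to the limit, not the measures. Exponentiation turns the double sum into the product
  over ordered pairs times the diagonal terms.\<close>

lemma log_capacity_conformal_images_ge:
  fixes f :: "'i \<Rightarrow> complex \<Rightarrow> complex"
  assumes I: "finite I" "I \<noteq> {}"
    and holo: "\<And>i. i \<in> I \<Longrightarrow> f i holomorphic_on ball 0 1"
    and inj: "\<And>i. i \<in> I \<Longrightarrow> inj_on (f i) (ball 0 1)"
    and disj: "disjoint_family_on (\<lambda>i. f i ` ball 0 1) I"
    and E: "bounded E" "E \<in> sets borel" "\<And>i. i \<in> I \<Longrightarrow> f i ` ball 0 1 \<subseteq> E"
  shows "((\<Prod>(i, j)\<in>{(i, j). i \<in> I \<and> j \<in> I \<and> i \<noteq> j}. cmod (f i 0 - f j 0)) *
          (\<Prod>i\<in>I. cmod (deriv (f i) 0))) powr (1 / (real (card I))\<^sup>2) \<le> log_capacity E"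
proof -
  define T where "T = (\<Sum>i\<in>I. \<Sum>j\<in>I. if i = j then ln (cmod (deriv (f i) 0)) else ln (cmod (f i 0 - f j 0)))"
  define c where "c = T / (real (card I))\<^sup>2"
  have "robin_constant E \<le> ereal (- ln r - c)" if "0 < r" "r < 1" for r
    unfolding c_def T_def using robin_constant_conformal_images_le[OF assms that] by simp
  then have "eventually (\<lambda>r. robin_constant E \<le> ereal (- ln r - c)) (at_left 1)"
    by (auto intro!: eventually_at_leftI[of 0])
  moreover have "((\<lambda>r. ereal (- ln r - c)) \<longlongrightarrow> ereal (- ln 1 - c)) (at_left 1)"
    by (intro tendsto_intros) auto
  ultimately have "robin_constant E \<le> ereal (- c)"
    by (auto intro: tendsto_lowerbound)
  from log_capacity_ge[OF \<open>bounded E\<close> this]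
  have "exp (T / (real (card I))\<^sup>2) \<le> log_capacity E"
    by (simp add: c_def)
  moreover have "((\<Prod>(i, j)\<in>{(i, j). i \<in> I \<and> j \<in> I \<and> i \<noteq> j}. cmod (f i 0 - f j 0)) *
          (\<Prod>i\<in>I. cmod (deriv (f i) 0))) = exp T"
  proof -
    define P where "P = {(i, j). i \<in> I \<and> j \<in> I \<and> i \<noteq> j}"
    have fin: "finite P"
      by (rule finite_subset[of _ "I \<times> I"]) (use I in \<open>auto simp: P_def\<close>)
    \<comment> \<open>Undoing ln by exp requires positive factors: injectivity makes the derivatives
      nonzero, disjointness of the images separates the centres.\<close>
    have d_nz: "cmod (deriv (f i) 0) > 0" if "i \<in> I" for i
      using holomorphic_injective_imp_regular[OF holo[OF that] open_ball inj[OF that], of 0] by simp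
    have p_nz: "cmod (f i 0 - f j 0) > 0" if "(i, j) \<in> P" for i j
      using disjoint_family_onD[OF disj, of i j] that by (force simp: P_def)
    have "T = (\<Sum>(i, j)\<in>I \<times> I. if i = j then ln (cmod (deriv (f i) 0)) else ln (cmod (f i 0 - f j 0)))"
      by (simp add: T_def sum.cartesian_product)
    also have "I \<times> I = P \<union> (\<lambda>i. (i, i)) ` I"
      by (auto simp: P_def)
    also have "(\<Sum>(i, j)\<in>\<dots>. if i = j then ln (cmod (deriv (f i) 0)) else ln (cmod (f i 0 - f j 0))) =
        (\<Sum>(i, j)\<in>P. if i = j then ln (cmod (deriv (f i) 0)) else ln (cmod (f i 0 - f j 0))) +
        (\<Sum>(i, j)\<in>(\<lambda>i. (i, i)) ` I. if i = j then ln (cmod (deriv (f i) 0)) else ln (cmod (f i 0 - f j 0)))"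
      using fin I by (intro sum.union_disjoint) (auto simp: P_def)
    also have "(\<Sum>(i, j)\<in>P. if i = j then ln (cmod (deriv (f i) 0)) else ln (cmod (f i 0 - f j 0))) =
        (\<Sum>(i, j)\<in>P. ln (cmod (f i 0 - f j 0)))"
      by (rule sum.cong) (auto simp: P_def)
    also have "(\<Sum>(i, j)\<in>(\<lambda>i. (i, i)) ` I. if i = j then ln (cmod (deriv (f i) 0)) else ln (cmod (f i 0 - f j 0))) =
        (\<Sum>i\<in>I. ln (cmod (deriv (f i) 0)))"
      by (subst sum.reindex) (auto simp: inj_on_def)
    finally have "exp T = (\<Prod>(i, j)\<in>P. exp (ln (cmod (f i 0 - f j 0)))) *
        (\<Prod>i\<in>I. exp (ln (cmod (deriv (f i) 0))))"
      using fin I by (simp add: exp_add exp_sum case_prod_unfold)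
    also have "\<dots> = (\<Prod>(i, j)\<in>P. cmod (f i 0 - f j 0)) * (\<Prod>i\<in>I. cmod (deriv (f i) 0))"
      using d_nz p_nz by (intro arg_cong2[of _ _ _ _ "(*)"] prod.cong) (auto simp: P_def)
    finally show ?thesis by (simp add: P_def)
  qed
  ultimately show ?thesis
    by (simp add: powr_def)
qed

section \<open>Inverse branches of a rational function\<close>

lemma analytic_Jordan_curve_imp_simple_path:
  assumes "analytic_Jordan_curve C"
  obtains c where "simple_path c" "pathfinish c = pathstart c" "path_image c = C"
proof -
  obtain \<phi> U where \<phi>: "open U" "sphere 0 1 \<subseteq> U" "\<phi> holomorphic_on U" "inj_on \<phi> U" "C = \<phi> ` sphere 0 1"
    using assms by (auto simp: analytic_Jordan_curve_def)
  have "simple_path (\<phi> \<circ> circlepath 0 1)"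
    using \<phi> by (intro simple_path_continuous_image holomorphic_on_imp_continuous_on)
      (auto intro: holomorphic_on_subset inj_on_subset simp: simple_path_circlepath)
  moreover have "path_image (\<phi> \<circ> circlepath 0 1) = C"
    using \<phi> by (simp add: path_image_compose)
  ultimately show thesis
    by (intro that[of "\<phi> \<circ> circlepath 0 1"]) (simp_all add: pathfinish_compose pathstart_compose)
qed

text \<open>For |\<zeta>| < 1 this shows that comparing numerator and denominator of the Blaschke
  factor amounts to comparing |u| and |v|. It serves both for equality on the boundary and for the
  inequality inside.\<close>

lemma norm_Blaschke_identity:
  fixes u v \<zeta> :: complex
  shows "(cmod (u - cnj \<zeta> * v))\<^sup>2 - (cmod (v - \<zeta> * u))\<^sup>2 = ((cmod u)\<^sup>2 - (cmod v)\<^sup>2) * (1 - (cmod \<zeta>)\<^sup>2)"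
  unfolding cmod_power2 by (simp add: algebra_simps power2_eq_square)

text \<open>If \<open>Q - \<zeta>P\<close> had no zero in \<open>V\<close>, the maximum principle for the reciprocal of the Blaschke factor
  \<open>(Q - \<zeta>P) / (P - cnj \<zeta> Q)\<close>, unimodular on the boundary, would force \<open>|P| = |Q|\<close> on \<open>V\<close>, so that
  \<open>Q / P\<close> would be constant.\<close>

lemma exists_root_in_domain:
  fixes P Q :: "complex poly"
  assumes deg: "degree P < degree Q"
    and V: "open V" "V \<noteq> {}" "bounded V"
    and le: "\<And>z. z \<in> V \<Longrightarrow> cmod (poly Q z) \<le> cmod (poly P z)"
    and bd: "\<And>z. z \<in> frontier V \<Longrightarrow> cmod (poly Q z) = cmod (poly P z)"
    and nz: "\<And>z. poly P z \<noteq> 0 \<or> poly Q z \<noteq> 0"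
    and \<zeta>: "cmod \<zeta> < 1"
  shows "\<exists>z\<in>V. poly Q z = \<zeta> * poly P z"
proof (rule ccontr)
  assume no_root: "\<not> ?thesis"
  \<comment> \<open>On the frontier |Q| = |P| and |\<zeta>| < 1, so a zero of Q - \<zeta>P would be
    a common zero of P and Q.\<close>
  have den: "poly Q z - \<zeta> * poly P z \<noteq> 0" if "z \<in> closure V" for z
  proof (cases "z \<in> V")
    case False
    then have "z \<in> frontier V"
      using that V by (simp add: frontier_def interior_open)
    then show ?thesis
      using bd[of z] nz[of z] \<zeta> by (auto simp: norm_mult)
  qed (use no_root in auto)
  define h where "h z = (poly P z - cnj \<zeta> * poly Q z) / (poly Q z - \<zeta> * poly P z)" for z
  have \<zeta>2: "1 - (cmod \<zeta>)\<^sup>2 > 0"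
    using \<zeta> by (simp add: abs_square_less_1)
  have h_frontier: "cmod (h z) \<le> 1" if "z \<in> frontier V" for z
  proof -
    have "(cmod (poly P z - cnj \<zeta> * poly Q z))\<^sup>2 = (cmod (poly Q z - \<zeta> * poly P z))\<^sup>2"
      using norm_Blaschke_identity[of "poly P z" \<zeta> "poly Q z"] bd[OF that] by simp
    then show ?thesis
      by (simp add: h_def norm_divide)
  qed
  have eq: "cmod (poly Q z) = cmod (poly P z)" if "z \<in> V" for z
  proof -
    have "cmod (h z) \<le> 1"
    proof (rule maximum_modulus_frontier[where f = h and S = V])
      show "h holomorphic_on interior V"
        unfolding h_def using den closure_subset[of V] V
        by (intro holomorphic_intros) (auto simp: interior_open)
      show "continuous_on (closure V) h"
        unfolding h_def using den by (intro continuous_intros) auto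
    qed (use V h_frontier that in auto)
    then have "cmod (poly P z - cnj \<zeta> * poly Q z) \<le> cmod (poly Q z - \<zeta> * poly P z)"
      using den[of z] closure_subset[of V] that by (auto simp: h_def norm_divide divide_le_eq_1)
    then have "((cmod (poly P z))\<^sup>2 - (cmod (poly Q z))\<^sup>2) * (1 - (cmod \<zeta>)\<^sup>2) \<le> 0"
      unfolding norm_Blaschke_identity[symmetric] by (simp add: power_mono)
    then have "(cmod (poly P z))\<^sup>2 \<le> (cmod (poly Q z))\<^sup>2"
      using \<zeta>2 by (simp add: mult_le_0_iff)
    then show ?thesis
      using le[OF that] by (simp add: power2_le_iff_abs_le)
  qed
  obtain x e where x: "0 < e" "ball x e \<subseteq> V"
    using V by (meson openE ex_in_conv)
  have P_nz: "poly P z \<noteq> 0" if "z \<in> ball x e" for z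
    using eq[of z] nz[of z] x that by auto
  \<comment> \<open>A holomorphic function of constant modulus attains its maximum at the centre,
    hence is constant; then Q = cP on infinitely many points, against the degrees.\<close>
  have "(\<lambda>z. poly Q z / poly P z) constant_on ball x e"
  proof (rule maximum_modulus_principle[where U = "ball x e" and \<xi> = x])
    show "(\<lambda>z. poly Q z / poly P z) holomorphic_on ball x e"
      using P_nz by (intro holomorphic_intros) auto
    have "cmod (poly Q z / poly P z) = 1" if "z \<in> ball x e" for z
      using eq[of z] P_nz[OF that] x that by (auto simp: norm_divide)
    then show "cmod (poly Q z / poly P z) \<le> cmod (poly Q x / poly P x)" if "z \<in> ball x e" for z
      using that x by simp
  qed (use x in auto)
  then obtain c where "\<And>z. z \<in> ball x e \<Longrightarrow> poly Q z / poly P z = c"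
    by (auto simp: constant_on_def)
  then have "ball x e \<subseteq> {z. poly (Q - smult c P) z = 0}"
    using P_nz by (auto simp: field_simps)
  moreover have "infinite (ball x e)"
    using x finite_imp_not_open[of "ball x e"] by auto
  ultimately have "Q - smult c P = 0"
    using poly_roots_finite finite_subset by blast
  then show False
    using deg degree_smult_le[of c P] by simp
qed

text \<open>Each of the \<open>d\<close> disjoint domains contains a root of the degree \<open>d\<close> polynomial \<open>Q - \<zeta>P\<close>,
  hence exactly one.\<close>

lemma inverse_branch_exists:
  fixes P Q :: "complex poly" and V :: "nat \<Rightarrow> complex set"
  assumes deg: "degree P < degree Q" "degree Q = d"
    and V: "\<And>k. k \<in> {1..d} \<Longrightarrow> open (V k)" "\<And>k. k \<in> {1..d} \<Longrightarrow> V k \<noteq> {}"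
      "\<And>k. k \<in> {1..d} \<Longrightarrow> bounded (V k)" "disjoint_family_on V {1..d}"
    and le: "\<And>k z. k \<in> {1..d} \<Longrightarrow> z \<in> V k \<Longrightarrow> cmod (poly Q z) \<le> cmod (poly P z)"
    and bd: "\<And>k z. k \<in> {1..d} \<Longrightarrow> z \<in> frontier (V k) \<Longrightarrow> cmod (poly Q z) = cmod (poly P z)"
    and nz: "\<And>z. poly P z \<noteq> 0 \<or> poly Q z \<noteq> 0"
    and k: "k \<in> {1..d}"
  shows "\<exists>f. f holomorphic_on ball 0 1 \<and> f ` ball 0 1 \<subseteq> V k \<and>
    (\<forall>\<zeta>\<in>ball 0 1. poly Q (f \<zeta>) = \<zeta> * poly P (f \<zeta>))"
proof -
  have root: "\<exists>z\<in>V j. poly Q z = \<zeta> * poly P z" if "j \<in> {1..d}" "cmod \<zeta> < 1" for j \<zeta>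
    using that by (intro exists_root_in_domain deg V le bd nz) auto
  have unique: "z = z'"
    if "cmod \<zeta> < 1" "z \<in> V k" "z' \<in> V k" "poly Q z = \<zeta> * poly P z" "poly Q z' = \<zeta> * poly P z'" for \<zeta> z z'
  proof (rule ccontr)
    assume "z \<noteq> z'"
    have "\<forall>j\<in>{1..d}. \<exists>z. z \<in> V j \<and> poly Q z = \<zeta> * poly P z"
      using root \<open>cmod \<zeta> < 1\<close> by blast
    from bchoice[OF this] obtain s0
      where s0: "\<And>j. j \<in> {1..d} \<Longrightarrow> s0 j \<in> V j \<and> poly Q (s0 j) = \<zeta> * poly P (s0 j)"
      by blast
    \<comment> \<open>One root per domain, with \<open>z\<close> chosen in \<open>V k\<close>. If
      \<open>z'\<close> differs from \<open>z\<close>, it is a root number d + 1 of a polynomial of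
      degree d.\<close>
    define s where "s = s0(k := z)"
    have s: "s j \<in> V j" "poly Q (s j) = \<zeta> * poly P (s j)" if "j \<in> {1..d}" for j
      using s0[OF that] \<open>z \<in> V k\<close> \<open>poly Q z = \<zeta> * poly P z\<close> by (auto simp: s_def)
    have disj: "i = j" if "i \<in> {1..d}" "j \<in> {1..d}" "x \<in> V i" "x \<in> V j" for i j x
      using disjoint_family_onD[OF V(4), of i j] that by auto
    have inj: "inj_on s {1..d}"
      by (rule inj_onI) (metis disj s(1))
    have "z' \<notin> s ` {1..d}"
    proof
      assume "z' \<in> s ` {1..d}"
      then obtain j where j: "j \<in> {1..d}" "z' = s j" by auto
      then have "j = k"
        using disj[of j k z'] s(1)[of j] k \<open>z' \<in> V k\<close> by simp
      then show False
        using \<open>z \<noteq> z'\<close> j by (simp add: s_def)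
    qed
    then have "card (insert z' (s ` {1..d})) = Suc d"
      using inj by (simp add: card_image)
    moreover define q where "q = Q - smult \<zeta> P"
    have "degree (smult \<zeta> P) < degree Q"
      using deg degree_smult_le[of \<zeta> P] by simp
    then have "degree q = d"
      using deg(2) degree_add_eq_left[of "- smult \<zeta> P" Q] by (simp add: q_def)
    moreover from this have "q \<noteq> 0"
      using deg by auto
    moreover have "insert z' (s ` {1..d}) \<subseteq> {x. poly q x = 0}"
      using s that by (auto simp: q_def)
    ultimately show False
      using card_mono[OF poly_roots_finite, of q "insert z' (s ` {1..d})"] card_poly_roots_bound[of q]
      by simp
  qed
  \<comment> \<open>The hypothesis \<open>le\<close> is not strict; passing to strict inequality
    makes P zero-free and sends Q / P into the open disc.\<close>
  define V' where "V' = V k \<inter> {z. cmod (poly Q z) < cmod (poly P z)}"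
  have open_V': "open V'"
    unfolding V'_def using V k by (intro open_Int open_Collect_less continuous_intros) auto
  define g where "g z = poly Q z / poly P z" for z
  have P_nz: "poly P z \<noteq> 0" if "z \<in> V'" for z
    using that by (auto simp: V'_def)
  have g_less: "cmod (g z) < 1" if "z \<in> V'" for z
    using that P_nz[OF that] by (simp add: V'_def g_def norm_divide)
  have g_holo: "g holomorphic_on V'"
    unfolding g_def using P_nz by (intro holomorphic_intros) auto
  have g_inj: "inj_on g V'"
  proof (rule inj_onI)
    fix z z' assume *: "z \<in> V'" "z' \<in> V'" "g z = g z'"
    show "z = z'"
    proof (rule unique[of "g z"])
      show "poly Q z = g z * poly P z"
        using P_nz[OF *(1)] by (simp add: g_def)
      show "poly Q z' = g z * poly P z'"
        using P_nz[OF *(2)] by (simp add: *(3)) (simp add: g_def)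
    qed (use * g_less in \<open>auto simp: V'_def\<close>)
  qed
  have g_image: "g ` V' = ball 0 1"
  proof (intro equalityI subsetI)
    fix \<zeta> :: complex assume \<zeta>: "\<zeta> \<in> ball 0 1"
    then obtain z where z: "z \<in> V k" "poly Q z = \<zeta> * poly P z"
      using root[OF k, of \<zeta>] by auto
    then have "poly P z \<noteq> 0"
      using nz[of z] by auto
    then have "z \<in> V'" "g z = \<zeta>"
      using z \<zeta> by (auto simp: V'_def g_def norm_mult)
    then show "\<zeta> \<in> g ` V'" by auto
  qed (use g_less in auto)
  obtain f where f: "f holomorphic_on g ` V'" "\<And>z. z \<in> V' \<Longrightarrow> f (g z) = z"
    using holomorphic_has_inverse[OF g_holo open_V' g_inj] by metis
  have "f \<zeta> \<in> V' \<and> poly Q (f \<zeta>) = \<zeta> * poly P (f \<zeta>)" if \<zeta>: "\<zeta> \<in> ball 0 1" for \<zeta>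
  proof -
    obtain z where z: "z \<in> V'" "\<zeta> = g z"
      using \<zeta> unfolding g_image[symmetric] by auto
    then show ?thesis
      using f(2)[OF z(1)] P_nz[OF z(1)] by (simp add: g_def)
  qed
  then show ?thesis
    using f(1)[unfolded g_image] by (intro exI[of _ f]) (auto simp: V'_def)
qed

text \<open>Multiplying the partial fraction identity by f(\<zeta>) - p_i isolates a_i: the quotient
  (f(\<zeta>) - p_i) / \<zeta> equals a_i plus (f(\<zeta>) - p_i) times a sum that stays bounded
  near the pole p_i, because the poles are distinct.\<close>

lemma deriv_inverse_branch:
  assumes f: "f holomorphic_on ball 0 1" "f 0 = p i" "\<And>\<zeta>. \<zeta> \<in> ball 0 1 - {0} \<Longrightarrow> f \<zeta> \<notin> p ` I"
    and eq: "\<And>\<zeta>. \<zeta> \<in> ball 0 1 - {0} \<Longrightarrow> (\<Sum>j\<in>I. a j / (f \<zeta> - p j)) = 1 / \<zeta>"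
    and I: "finite I" "i \<in> I" "inj_on p I"
  shows "deriv f 0 = a i"
proof -
  have "(f \<longlongrightarrow> f 0) (at 0)"
    using holomorphic_on_imp_continuous_on[OF f(1)]
    by (simp add: continuous_on_eq_continuous_at continuous_at)
  then have lim: "(f \<longlongrightarrow> p i) (at 0)"
    using f by simp
  have "((\<lambda>\<zeta>. a i + (f \<zeta> - p i) * (\<Sum>j\<in>I - {i}. a j / (f \<zeta> - p j))) \<longlongrightarrow>
      a i + (p i - p i) * (\<Sum>j\<in>I - {i}. a j / (p i - p j))) (at 0)"
    using I by (intro tendsto_intros lim) (auto dest: inj_onD)
  then have "((\<lambda>\<zeta>. a i + (f \<zeta> - p i) * (\<Sum>j\<in>I - {i}. a j / (f \<zeta> - p j))) \<longlongrightarrow> a i) (at 0)"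
    by simp
  moreover have "\<forall>\<^sub>F \<zeta> in at 0. a i + (f \<zeta> - p i) * (\<Sum>j\<in>I - {i}. a j / (f \<zeta> - p j)) = (f (0 + \<zeta>) - f 0) / \<zeta>"
  proof (rule eventually_mono[OF eventually_at_in_open[of "ball 0 1"]])
    fix \<zeta> :: complex assume \<zeta>: "\<zeta> \<in> ball 0 1 - {0}"
    have "f \<zeta> - p i \<noteq> 0"
      using f(3)[OF \<zeta>] I by auto
    moreover have "(\<Sum>j\<in>I - {i}. a j / (f \<zeta> - p j)) = 1 / \<zeta> - a i / (f \<zeta> - p i)"
      using eq[OF \<zeta>] I by (simp add: sum.remove[of I i] eq_diff_eq add.commute)
    ultimately show "a i + (f \<zeta> - p i) * (\<Sum>j\<in>I - {i}. a j / (f \<zeta> - p j)) = (f (0 + \<zeta>) - f 0) / \<zeta>"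
      using \<zeta> f(2) by (simp add: right_diff_distrib)
  qed auto
  ultimately have "(\<lambda>\<zeta>. (f (0 + \<zeta>) - f 0) / \<zeta>) \<midarrow>0\<rightarrow> a i"
    by (rule Lim_transform_eventually)
  then have "DERIV f 0 :> a i"
    by (simp add: DERIV_def)
  then show ?thesis
    by (rule DERIV_imp_deriv)
qed

section \<open>Topology of the sphere and the boundary curves\<close>

text \<open>Off C, the sphere splits into the inside and the rest with infinity. The latter is open
  because C together with its inside is compact; as \<Omega> contains infinity, connectedness keeps
  it there.\<close>

lemma sphere_connected_disjoint_inside:
  assumes conn: "connectedin riemann_sphere \<Omega>" and inf: "None \<in> \<Omega>"
    and C: "compact C" and disj: "\<Omega> \<inter> Some ` C = {}"
  shows "Some -` \<Omega> \<inter> inside C = {}"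
proof (rule ccontr)
  assume ne: "Some -` \<Omega> \<inter> inside C \<noteq> {}"
  have "bounded (C \<union> inside C)"
    using C by (simp add: bounded_inside compact_imp_bounded)
  moreover have "closed (C \<union> inside C)"
    using C by (simp add: union_with_inside closed_Compl open_outside compact_imp_closed)
  ultimately have comp: "compact (C \<union> inside C)"
    by (simp add: compact_eq_bounded_closed)
  have "openin riemann_sphere (Some ` inside C)"
    using C by (simp add: riemann_sphere_def open_inside compact_imp_closed flip: open_openin)
  moreover have "openin riemann_sphere (insert None (Some ` (UNIV - (C \<union> inside C))))"
    unfolding riemann_sphere_def openin_Alexandroff_compactification
    using comp by (intro disjI2 exI[of _ "C \<union> inside C"]) (auto simp: compact_imp_closed)
  moreover have "\<Omega> \<subseteq> Some ` inside C \<union> insert None (Some ` (UNIV - (C \<union> inside C)))"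
  proof
    fix x assume "x \<in> \<Omega>"
    then show "x \<in> Some ` inside C \<union> insert None (Some ` (UNIV - (C \<union> inside C)))"
      using disj by (cases x) (auto simp: image_iff disjoint_iff)
  qed
  ultimately show False
    using connectedinD[OF conn, of "Some ` inside C" "insert None (Some ` (UNIV - (C \<union> inside C)))"]
      ne inf by auto
qed

lemma frontier_of_riemann_sphere_Some:
  assumes z: "Some z \<in> riemann_sphere frontier_of \<Omega>" and "open (Some -` \<Omega>)"
  shows "Some z \<notin> \<Omega>" "z \<in> closure (Some -` \<Omega>)"
proof -
  have op: "openin riemann_sphere (Some ` U)" if "open U" for U :: "complex set"
    using that by (simp add: riemann_sphere_def)
  show "Some z \<notin> \<Omega>"
  proof
    assume "Some z \<in> \<Omega>"
    then have "Some z \<in> riemann_sphere interior_of \<Omega>"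
      unfolding interior_of_def using op[OF assms(2)] by auto
    then show False
      using z by (simp add: frontier_of_def)
  qed
  have *: "\<exists>y\<in>\<Omega>. y \<in> T" if "Some z \<in> T" "openin riemann_sphere T" for T
    using z that by (auto simp: frontier_of_def closure_of_def)
  have "Some -` \<Omega> \<inter> U \<noteq> {}" if "open U" "z \<in> U" for U
    using *[OF _ op[OF that(1)]] that(2) by auto
  then show "z \<in> closure (Some -` \<Omega>)"
    by (auto simp: closure_iff_nhds_not_empty)
qed

text \<open>Disjoint Jordan curves may be nested; \<open>no\<close> excludes this. If the insides
  met, the connected inside of \<open>c\<close> would lie in that of \<open>c'\<close>, and taking
  closures would put the curve \<open>c\<close> inside or on \<open>c'\<close>.\<close>

lemma insides_disjoint:
  fixes c c' :: "real \<Rightarrow> complex"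
  assumes J: "simple_path c" "pathfinish c = pathstart c" "simple_path c'" "pathfinish c' = pathstart c'"
    and disj: "path_image c \<inter> path_image c' = {}"
    and no: "path_image c \<inter> inside (path_image c') = {}" "path_image c' \<inter> inside (path_image c) = {}"
  shows "inside (path_image c) \<inter> inside (path_image c') = {}"
proof (rule ccontr)
  assume ne: "inside (path_image c) \<inter> inside (path_image c') \<noteq> {}"
  note c = Jordan_inside_outside[OF J(1,2)] and c' = Jordan_inside_outside[OF J(3,4)]
  have "outside (path_image c') \<inter> inside (path_image c) = {}"
    using inside_outside_intersect_connected[of "inside (path_image c)" "path_image c'"] c ne no by blast
  then have "inside (path_image c) \<subseteq> inside (path_image c')"
    using c' no by blast
  then have "closure (inside (path_image c)) \<subseteq> closure (inside (path_image c'))"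
    by (rule closure_mono)
  moreover have "path_image c \<subseteq> closure (inside (path_image c))"
    using c by (auto simp: frontier_def)
  moreover have "closure (inside (path_image c')) = inside (path_image c') \<union> path_image c'"
    using c' closure_Un_frontier[of "inside (path_image c')"] by simp
  ultimately show False
    using disj no path_image_nonempty[of c] by blast
qed

lemma coprime_poly_no_common_root:
  fixes P Q :: "'a :: field poly"
  assumes "coprime P Q"
  shows "poly P z \<noteq> 0 \<or> poly Q z \<noteq> 0"
  using coprime_common_divisor[OF assms, of "[:- z, 1:]"]
  by (auto simp: poly_eq_0_iff_dvd is_unit_poly_iff)

text \<open>Components are closed in \<open>K\<close>; this supplies the Borel measurability that
  the capacity estimate asks of K_i.\<close>

lemma closed_component_vimage:
  assumes "closed (Some -` K)"
  shows "closed (Some -` connected_component_of_set (subtopology riemann_sphere K) x)"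
proof -
  obtain T where T: "closedin riemann_sphere T"
    "connected_component_of_set (subtopology riemann_sphere K) x = T \<inter> K"
    using closedin_connected_component_of[of "subtopology riemann_sphere K" x]
    by (auto simp: closedin_subtopology)
  have "closed (Some -` T)"
    using closedin_continuous_map_preimage[OF continuous_map_Some[of euclidean] T(1)[unfolded riemann_sphere_def]]
    by (simp add: vimage_def)
  then show ?thesis
    using assms by (simp add: T(2) vimage_Int closed_Int)
qed

lemma connected_subset_component_vimage:
  assumes "connected S" "S \<subseteq> Some -` K" "x \<in> S"
  shows "S \<subseteq> Some -` connected_component_of_set (subtopology riemann_sphere K) (Some x)"
proof -
  have "connectedin riemann_sphere (Some ` S)"
    unfolding riemann_sphere_def using assms(1)
    by (intro connectedin_continuous_map_image[OF continuous_map_Some]) simp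
  then have "connectedin (subtopology riemann_sphere K) (Some ` S)"
    using assms(2) by (auto simp: connectedin_subtopology)
  then have "Some ` S \<subseteq> connected_component_of_set (subtopology riemann_sphere K) (Some x)"
    using assms(3) by (intro connected_component_of_maximal) auto
  then show ?thesis by auto
qed

text \<open>P / Q tends to 0 at infinity, so |Q| \<le> |P| fails outside a large disc.\<close>

lemma bounded_poly_le:
  fixes P Q :: "complex poly"
  assumes "degree P < degree Q"
  shows "bounded {z. cmod (poly Q z) \<le> cmod (poly P z)}"
proof -
  have "((\<lambda>z. cmod (poly P z / poly Q z)) \<longlongrightarrow> 0) at_infinity"
    using poly_divide_tendsto_0_at_infinity[OF assms] by (rule tendsto_norm_zero)
  then have "\<forall>\<^sub>F z in at_infinity. cmod (poly P z / poly Q z) < 1"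
    by (rule order_tendstoD) simp
  moreover have "\<forall>\<^sub>F z in at_infinity. poly Q z \<noteq> 0"
    by (intro filterlim_at_infinity_imp_eventually_ne filterlim_poly_at_infinity) (use assms in auto)
  ultimately have "\<forall>\<^sub>F z in at_infinity. \<not> cmod (poly Q z) \<le> cmod (poly P z)"
    by eventually_elim (simp add: norm_divide)
  then obtain b where "\<And>z. b \<le> cmod z \<Longrightarrow> \<not> cmod (poly Q z) \<le> cmod (poly P z)"
    by (auto simp: eventually_at_infinity)
  then show ?thesis
    by (intro boundedI[of _ b]) (metis linorder_le_cases mem_Collect_eq)
qed

section \<open>The capacity estimates\<close>

theorem theorem4p1:
  fixes d :: nat
    and R :: "complex option \<Rightarrow> complex option"
    and a p :: "nat \<Rightarrow> complex"
    and K :: "complex option set"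
    and K_comp :: "nat \<Rightarrow> complex option set"
  assumes d: "d \<ge> 1"
    and good: "good_rational_function d R"
    and a_nz: "\<And>i. i \<in> {1..d} \<Longrightarrow> a i \<noteq> 0"
    and p_distinct: "inj_on p {1..d}"
    and R_eq: "\<And>z. z \<notin> p ` {1..d} \<Longrightarrow> R (Some z) = Some (\<Sum>i=1..d. a i / (z - p i))"
    and K_eq: "K = {z. cmod_ext (R z) \<ge> 1}"
    and K_comp_eq: "\<And>i. i \<in> {1..d} \<Longrightarrow>
           K_comp i = connected_component_of_set (subtopology riemann_sphere K) (Some (p i))"
  shows "(\<forall>i\<in>{1..d}. log_capacity (Some -` K_comp i) \<ge> cmod (a i)) \<and>
         log_capacity (Some -` K) \<ge>
           ((\<Prod>(i, j)\<in>{(i, j). i \<in> {1..d} \<and> j \<in> {1..d} \<and> i \<noteq> j}. cmod (p i - p j)) *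
            (\<Prod>i=1..d. cmod (a i))) powr (1 / (real d)\<^sup>2)"
proof -
  obtain P Q where PQ: "Q \<noteq> 0" "coprime P Q" "max (degree P) (degree Q) = d" "R = rational_map P Q"
    using good by (auto simp: good_rational_function_def rational_function_of_degree_def)
  have R_inf: "R None = Some 0"
    using good by (simp add: good_rational_function_def)
  then have "degree P \<le> degree Q" and "coeff P (degree Q) = 0"
    using PQ(1,4) by (auto simp: rational_map_def split: if_splits)
  then have deg_Q: "degree Q = d"
    using PQ(3) by simp
  \<comment> \<open>Equal degrees would make the vanishing coefficient the leading one, so P = 0 and
    d = 0.\<close>
  have "degree P \<noteq> degree Q"
    using \<open>coeff P (degree Q) = 0\<close> d deg_Q leading_coeff_0_iff[of P] by force
  with \<open>degree P \<le> degree Q\<close> have deg_P: "degree P < degree Q"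
    by simp
  have nz: "poly P z \<noteq> 0 \<or> poly Q z \<noteq> 0" for z
    using coprime_poly_no_common_root[OF PQ(2)] .
  define \<Omega> where "\<Omega> = R -` {w. cmod_ext w < 1}"
  have K_\<Omega>: "K = - \<Omega>"
    by (auto simp: K_eq \<Omega>_def not_less)
  \<comment> \<open>At a pole both sides fail: \<open>cmod_ext None\<close> is \<infinity>, and no
    modulus is below 0.\<close>
  have \<Omega>_Some: "Some -` \<Omega> = {z. cmod (poly P z) < cmod (poly Q z)}"
    by (auto simp: \<Omega>_def PQ(4) rational_map_def cmod_ext_def norm_divide one_ereal_def)
  have K_Some: "Some -` K = {z. cmod (poly Q z) \<le> cmod (poly P z)}"
    unfolding K_\<Omega> vimage_Compl \<Omega>_Some by (auto simp: not_less)
  have open_\<Omega>: "open (Some -` \<Omega>)"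
    unfolding \<Omega>_Some by (intro open_Collect_less continuous_intros)
  have closed_K: "closed (Some -` K)"
    unfolding K_Some by (intro closed_Collect_le continuous_intros)
  have bounded_K: "bounded (Some -` K)"
    unfolding K_Some by (rule bounded_poly_le[OF deg_P])
  have None_\<Omega>: "None \<in> \<Omega>"
    by (simp add: \<Omega>_def R_inf cmod_ext_def zero_ereal_def[symmetric])
  have conn: "connectedin riemann_sphere \<Omega>"
    and "\<exists>\<gamma> :: nat \<Rightarrow> complex set. (\<forall>i\<in>{1..d}. analytic_Jordan_curve (\<gamma> i)) \<and> disjoint_family_on \<gamma> {1..d} \<and>
      riemann_sphere frontier_of \<Omega> = (\<Union>i\<in>{1..d}. Some ` \<gamma> i)"
    using good by (simp_all only: good_rational_function_def Let_def \<Omega>_def)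
  then obtain \<gamma> :: "nat \<Rightarrow> complex set"
    where \<gamma>: "\<forall>i\<in>{1..d}. analytic_Jordan_curve (\<gamma> i)" "disjoint_family_on \<gamma> {1..d}"
    and front: "riemann_sphere frontier_of \<Omega> = (\<Union>i\<in>{1..d}. Some ` \<gamma> i)"
    by (elim exE conjE)
  have "\<forall>k\<in>{1..d}. \<exists>c. simple_path c \<and> pathfinish c = pathstart c \<and> path_image c = \<gamma> k"
    using \<gamma>(1) by (metis analytic_Jordan_curve_imp_simple_path)
  from bchoice[OF this] obtain c
    where c: "\<And>k. k \<in> {1..d} \<Longrightarrow> simple_path (c k)"
      "\<And>k. k \<in> {1..d} \<Longrightarrow> pathfinish (c k) = pathstart (c k)"
      "\<And>k. k \<in> {1..d} \<Longrightarrow> path_image (c k) = \<gamma> k"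
    by blast
  define V where "V k = inside (\<gamma> k)" for k
  have V: "open (V k)" "V k \<noteq> {}" "bounded (V k)" "frontier (V k) = \<gamma> k" if "k \<in> {1..d}" for k
    using Jordan_inside_outside[of "c k"] c[OF that] by (auto simp: V_def)
  have \<gamma>_\<Omega>: "Some z \<notin> \<Omega>" "z \<in> closure (Some -` \<Omega>)" if "k \<in> {1..d}" "z \<in> \<gamma> k" for k z
  proof -
    have "Some z \<in> riemann_sphere frontier_of \<Omega>"
      unfolding front using that by blast
    from frontier_of_riemann_sphere_Some[OF this open_\<Omega>]
    show "Some z \<notin> \<Omega>" "z \<in> closure (Some -` \<Omega>)" .
  qed
  have V_\<Omega>: "Some -` \<Omega> \<inter> V k = {}" if "k \<in> {1..d}" for k
    unfolding V_def
  proof (rule sphere_connected_disjoint_inside[OF conn None_\<Omega>])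
    show "compact (\<gamma> k)"
      using compact_simple_path_image[OF c(1)[OF that]] c(3)[OF that] by simp
    show "\<Omega> \<inter> Some ` \<gamma> k = {}"
      using \<gamma>_\<Omega>[OF that] by auto
  qed
  \<comment> \<open>An open set disjoint from \<Omega> is disjoint from its closure, which contains
    all the curves.\<close>
  have \<gamma>_V: "\<gamma> j \<inter> V k = {}" if "j \<in> {1..d}" "k \<in> {1..d}" for j k
  proof -
    have "closure (Some -` \<Omega>) \<inter> V k = {}"
      using V_\<Omega>[OF that(2)] open_Int_closure_eq_empty[OF V(1)[OF that(2)], of "Some -` \<Omega>"] by blast
    then show ?thesis
      using \<gamma>_\<Omega>(2)[OF that(1)] by blast
  qed
  have disj_V: "disjoint_family_on V {1..d}"
    unfolding disjoint_family_on_def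
  proof (intro ballI impI)
    fix j k assume jk: "j \<in> {1..d}" "k \<in> {1..d}" "j \<noteq> k"
    show "V j \<inter> V k = {}"
      using insides_disjoint[OF c(1,2)[OF jk(1)] c(1,2)[OF jk(2)]]
        disjoint_family_onD[OF \<gamma>(2) jk] \<gamma>_V[OF jk(1,2)] \<gamma>_V[OF jk(2,1)]
      by (simp add: c(3)[OF jk(1)] c(3)[OF jk(2)] V_def)
  qed
  have V_K: "V k \<subseteq> Some -` K" if "k \<in> {1..d}" for k
    using V_\<Omega>[OF that] by (auto simp: K_\<Omega>)
  \<comment> \<open>A curve lies in \<open>K\<close> and in the closure of \<Omega>; each membership
    gives one inequality.\<close>
  have on_\<gamma>: "cmod (poly Q z) = cmod (poly P z)" if "k \<in> {1..d}" "z \<in> \<gamma> k" for k z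
  proof (rule antisym)
    have "z \<in> Some -` K"
      using \<gamma>_\<Omega>(1)[OF that] by (simp add: K_\<Omega>)
    then show "cmod (poly Q z) \<le> cmod (poly P z)"
      unfolding K_Some by simp
    have "closure (Some -` \<Omega>) \<subseteq> {z. cmod (poly P z) \<le> cmod (poly Q z)}"
      unfolding \<Omega>_Some by (intro closure_minimal closed_Collect_le continuous_intros) auto
    then show "cmod (poly P z) \<le> cmod (poly Q z)"
      using \<gamma>_\<Omega>(2)[OF that] by auto
  qed
  have "\<forall>k\<in>{1..d}. \<exists>f. f holomorphic_on ball 0 1 \<and> f ` ball 0 1 \<subseteq> V k \<and>
    (\<forall>\<zeta>\<in>ball 0 1. poly Q (f \<zeta>) = \<zeta> * poly P (f \<zeta>))"
    by (intro ballI inverse_branch_exists[OF deg_P deg_Q V(1-3) disj_V _ _ nz])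
       (use V_K[unfolded K_Some] V(4) on_\<gamma> in auto)
  from bchoice[OF this] obtain g where
    g: "\<And>k. k \<in> {1..d} \<Longrightarrow> g k holomorphic_on ball 0 1"
      "\<And>k. k \<in> {1..d} \<Longrightarrow> g k ` ball 0 1 \<subseteq> V k"
      "\<And>k \<zeta>. k \<in> {1..d} \<Longrightarrow> \<zeta> \<in> ball 0 1 \<Longrightarrow> poly Q (g k \<zeta>) = \<zeta> * poly P (g k \<zeta>)"
    by blast
  have g0_V: "g k 0 \<in> V k" if "k \<in> {1..d}" for k
    using g(2)[OF that] by auto
  \<comment> \<open>At a root of Q the value of \<open>R\<close> is \<open>None\<close>, while
    \<open>R_eq\<close> yields a finite value away from the p_i.\<close>
  have Q_root: "z \<in> p ` {1..d}" if "poly Q z = 0" for z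
    using R_eq[of z] that by (auto simp: PQ(4) rational_map_def)
  have V_eq: "j = k" if "j \<in> {1..d}" "k \<in> {1..d}" "z \<in> V j" "z \<in> V k" for j k z
    using disjoint_family_onD[OF disj_V that(1,2)] that by auto
  have inj_g0: "inj_on (\<lambda>k. g k 0) {1..d}"
    by (rule inj_onI) (metis V_eq g0_V)
  \<comment> \<open>The points g_k(0) are d distinct roots of Q among the d points p_i, so they
    exhaust them.\<close>
  have "(\<lambda>k. g k 0) ` {1..d} = p ` {1..d}"
  proof (rule card_subset_eq)
    show "(\<lambda>k. g k 0) ` {1..d} \<subseteq> p ` {1..d}"
    proof (rule image_subsetI)
      fix k assume "k \<in> {1..d}"
      then show "g k 0 \<in> p ` {1..d}"
        using g(3)[of k 0] by (intro Q_root) simp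
    qed
    show "card ((\<lambda>k. g k 0) ` {1..d}) = card (p ` {1..d})"
      using inj_g0 p_distinct by (simp add: card_image)
  qed auto
  then have "\<forall>i\<in>{1..d}. \<exists>k. k \<in> {1..d} \<and> g k 0 = p i"
    by (metis (no_types, lifting) imageE imageI)
  \<comment> \<open>Curves and poles are numbered independently; \<sigma> assigns to the i-th pole
    the curve that encloses it.\<close>
  from bchoice[OF this] obtain \<sigma>
    where \<sigma>: "\<And>i. i \<in> {1..d} \<Longrightarrow> \<sigma> i \<in> {1..d}" "\<And>i. i \<in> {1..d} \<Longrightarrow> g (\<sigma> i) 0 = p i"
    by blast
  define f where "f i = g (\<sigma> i)" for i
  have f_holo: "f i holomorphic_on ball 0 1"
    and f_V: "f i ` ball 0 1 \<subseteq> V (\<sigma> i)"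
    and f_root: "\<And>\<zeta>. \<zeta> \<in> ball 0 1 \<Longrightarrow> poly Q (f i \<zeta>) = \<zeta> * poly P (f i \<zeta>)"
    and f_0: "f i 0 = p i" if "i \<in> {1..d}" for i
    using g[OF \<sigma>(1)[OF that]] \<sigma>(2)[OF that] by (auto simp: f_def)
  have f_P: "poly P (f i \<zeta>) \<noteq> 0" if "i \<in> {1..d}" "\<zeta> \<in> ball 0 1" for i \<zeta>
    using f_root[OF that] nz[of "f i \<zeta>"] by auto
  \<comment> \<open>The parameter is recovered from the image point as Q / P there.\<close>
  have f_inj: "inj_on (f i) (ball 0 1)" if "i \<in> {1..d}" for i
  proof (rule inj_onI)
    fix z w :: complex assume zw: "z \<in> ball 0 1" "w \<in> ball 0 1" "f i z = f i w"
    then have "z * poly P (f i z) = w * poly P (f i z)"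
      using f_root[OF that zw(1)] f_root[OF that zw(2)] unfolding zw(3) by metis
    then show "z = w"
      using f_P[OF that zw(1)] by simp
  qed
  have f_disj: "disjoint_family_on (\<lambda>i. f i ` ball 0 1) {1..d}"
    unfolding disjoint_family_on_def
  proof (intro ballI impI)
    fix i j assume ij: "i \<in> {1..d}" "j \<in> {1..d}" "i \<noteq> j"
    then have "\<sigma> i \<noteq> \<sigma> j"
      using \<sigma>(2) inj_onD[OF p_distinct, of i j] by metis
    then show "f i ` ball 0 1 \<inter> f j ` ball 0 1 = {}"
      using f_V[OF ij(1)] f_V[OF ij(2)] disjoint_family_onD[OF disj_V \<sigma>(1)[OF ij(1)] \<sigma>(1)[OF ij(2)]]
      by blast
  qed
  have Q_p: "poly Q (p i) = 0" if "i \<in> {1..d}" for i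
    using f_root[OF that, of 0] f_0[OF that] by simp
  have f_deriv: "deriv (f i) 0 = a i" if i: "i \<in> {1..d}" for i
  proof (rule deriv_inverse_branch[where p = p and I = "{1..d}"])
    fix \<zeta> :: complex assume \<zeta>: "\<zeta> \<in> ball 0 1 - {0}"
    then have Q_nz: "poly Q (f i \<zeta>) \<noteq> 0"
      using f_root[OF i, of \<zeta>] f_P[OF i, of \<zeta>] by auto
    then show notin: "f i \<zeta> \<notin> p ` {1..d}"
      using Q_p by auto
    have "(\<Sum>j=1..d. a j / (f i \<zeta> - p j)) = poly P (f i \<zeta>) / poly Q (f i \<zeta>)"
      using R_eq[OF notin] Q_nz by (simp add: PQ(4) rational_map_def)
    also have "\<dots> = 1 / \<zeta>"
      using f_root[OF i, of \<zeta>] f_P[OF i, of \<zeta>] \<zeta> by simp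
    finally show "(\<Sum>j=1..d. a j / (f i \<zeta> - p j)) = 1 / \<zeta>" .
  qed (use i f_holo f_0 p_distinct in auto)
  have f_K: "f i ` ball 0 1 \<subseteq> Some -` K" if "i \<in> {1..d}" for i
    using f_V[OF that] V_K[OF \<sigma>(1)[OF that]] by blast
  have "cmod (a i) \<le> log_capacity (Some -` K_comp i)" if i: "i \<in> {1..d}" for i
  proof -
    \<comment> \<open>With one disc there are no mixed pairs and the exponent is 1, so the bound
      reduces to |f_i'(0)| = |a_i|.\<close>
    have "((\<Prod>(k, j)\<in>{(k, j). k \<in> {i} \<and> j \<in> {i} \<and> k \<noteq> j}. cmod (f k 0 - f j 0)) *
          (\<Prod>k\<in>{i}. cmod (deriv (f k) 0))) powr (1 / (real (card {i}))\<^sup>2) \<le> log_capacity (Some -` K_comp i)"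
    proof (rule log_capacity_conformal_images_ge)
      have "K_comp i \<subseteq> K"
        unfolding K_comp_eq[OF i] using connected_component_of_subset_topspace[of "subtopology riemann_sphere K"]
        by auto
      then show "bounded (Some -` K_comp i)"
        by (intro bounded_subset[OF bounded_K]) auto
      have "closed (Some -` K_comp i)"
        unfolding K_comp_eq[OF i] by (rule closed_component_vimage[OF closed_K])
      then show "Some -` K_comp i \<in> sets borel"
        by (rule borel_closed)
      have "connected (f i ` ball 0 1)"
        by (intro connected_continuous_image holomorphic_on_imp_continuous_on f_holo i) simp
      moreover have "p i \<in> f i ` ball 0 1"
        using f_0[OF i, symmetric] by auto
      ultimately show "f k ` ball 0 1 \<subseteq> Some -` K_comp i" if "k \<in> {i}" for k
        using connected_subset_component_vimage[OF _ f_K[OF i], of "p i"] that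
        by (simp only: K_comp_eq[OF i] singleton_iff)
    qed (use i f_holo f_inj in \<open>auto simp: disjoint_family_on_def\<close>)
    moreover have eq: "{(k, j). k \<in> {i} \<and> j \<in> {i} \<and> k \<noteq> j} = {}"
      by auto
    ultimately show ?thesis
      using f_deriv[OF i] unfolding eq by simp
  qed
  moreover have "((\<Prod>(i, j)\<in>{(i, j). i \<in> {1..d} \<and> j \<in> {1..d} \<and> i \<noteq> j}. cmod (f i 0 - f j 0)) *
      (\<Prod>i=1..d. cmod (deriv (f i) 0))) powr (1 / (real (card {1..d}))\<^sup>2) \<le> log_capacity (Some -` K)"
    using d f_holo f_inj f_disj bounded_K closed_K f_K
    by (intro log_capacity_conformal_images_ge) auto
  moreover have "(\<Prod>(i, j)\<in>{(i, j). i \<in> {1..d} \<and> j \<in> {1..d} \<and> i \<noteq> j}. cmod (f i 0 - f j 0)) =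
      (\<Prod>(i, j)\<in>{(i, j). i \<in> {1..d} \<and> j \<in> {1..d} \<and> i \<noteq> j}. cmod (p i - p j))"
    by (rule prod.cong) (auto simp: f_0)
  moreover have "(\<Prod>i=1..d. cmod (deriv (f i) 0)) = (\<Prod>i=1..d. cmod (a i))"
    by (rule prod.cong) (auto simp: f_deriv)
  ultimately show ?thesis
    by simp
qed

end
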